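(* Let $C$ be an algebraically closed subfield of $\mathbb{C}$, let $n$ be a prime number, and let $G\subset\mathrm{GL}_n(C)$ be an irreducible, imprimitive algebraic group such that $G/G^0$ is finite and cyclic. Then: (1) if $\det(G)=C^*$, then $G^0\cong(C^* )^n$ and $G/G^0\cong\mathbb{Z}/n\mathbb{Z}$; (2) if $\det(G)\cong\mathbb{Z}/\nu\mathbb{Z}$ (the group of $\nu$-th roots of unity) for some $\nu\in\mathbb{N}^*$, then $G^0\cong(C^* )^{n-1}$ and $G/G^0\cong\mathbb{Z}/ns\mathbb{Z}$, where $s=\nu/n$ if $\nu\in n\mathbb{N}^*$ and $s=\nu$ otherwise.
   Context: $G^0$ denotes the identity component of $G$. $G$ is irreducible if no nontrivial proper subspace of $C^n$ is invariant under all elements of $G$. $G$ is imprimitive if there is a nontrivial decomposition $C^n=V_1\oplus\dots\oplus V_k$ ($k\ge2$) into subspaces such that every element of $G$ permutes the $V_i$; otherwise it is primitive. *)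

theory Defs
  imports "HOL-Analysis.Analysis" "HOL-Algebra.Product_Groups"
begin

text \<open>
  The field \<open>C\<close> is a type \<open>'a\<close> of class \<open>alg_closed_field\<close>; being a subfield of the complex
  numbers is witnessed by an embedding of fields \<open>'a \<Rightarrow> complex\<close>.
\<close>

definition field_embedding :: "('a::field \<Rightarrow> 'b::field) \<Rightarrow> bool" where
  "field_embedding \<iota> \<longleftrightarrow>
     inj \<iota> \<and> \<iota> 0 = 0 \<and> \<iota> 1 = 1 \<and>
     (\<forall>x y. \<iota> (x + y) = \<iota> x + \<iota> y) \<and> (\<forall>x y. \<iota> (x * y) = \<iota> x * \<iota> y)"

definition GL :: "('a::field ^ 'n ^ 'n) monoid" where
  "GL = \<lparr>carrier = {A. invertible A}, monoid.mult = (**), one = mat 1\<rparr>"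

definition Gm :: "'a::field monoid" where
  "Gm = \<lparr>carrier = UNIV - {0}, monoid.mult = (*), one = 1\<rparr>"

definition torus :: "nat \<Rightarrow> (nat \<Rightarrow> 'a::field) monoid" where
  "torus m = product_group {..<m} (\<lambda>_. Gm)"


subsection \<open>Regular functions and the Zariski topology\<close>

text \<open>The algebra of functions generated by \<open>X\<close> over the base field:\<close>

inductive_set function_algebra :: "('b \<Rightarrow> 'a::field) set \<Rightarrow> ('b \<Rightarrow> 'a) set"
  for X :: "('b \<Rightarrow> 'a) set" where
  gen: "f \<in> X \<Longrightarrow> f \<in> function_algebra X"
| const: "(\<lambda>_. c) \<in> function_algebra X"
| add: "f \<in> function_algebra X \<Longrightarrow> g \<in> function_algebra X \<Longrightarrow>
    (\<lambda>x. f x + g x) \<in> function_algebra X"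
| mult: "f \<in> function_algebra X \<Longrightarrow> g \<in> function_algebra X \<Longrightarrow>
    (\<lambda>x. f x * g x) \<in> function_algebra X"

text \<open>
  The coordinate rings \<open>C[x\<^sub>i\<^sub>j, 1/det]\<close> and \<open>C[t\<^sub>i, 1/t\<^sub>i]\<close>. Their elements are total functions,
  but only the values on \<open>carrier GL\<close> and \<open>carrier (torus m)\<close> are ever used.
\<close>

definition GL_regular :: "('a::field ^ 'n ^ 'n \<Rightarrow> 'a) set" where
  "GL_regular = function_algebra
     (insert (\<lambda>A. inverse (det A)) {f. \<exists>i j. f = (\<lambda>A. A $ i $ j)})"

definition torus_regular :: "nat \<Rightarrow> ((nat \<Rightarrow> 'a::field) \<Rightarrow> 'a) set" where
  "torus_regular m = function_algebra
     ((\<lambda>i t. t i) ` {..<m} \<union> (\<lambda>i t. inverse (t i)) ` {..<m})"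

definition zariski_closed :: "('a::field ^ 'n ^ 'n) set \<Rightarrow> bool" where
  "zariski_closed Z \<longleftrightarrow>
     (\<exists>S \<subseteq> GL_regular. Z = {A \<in> carrier GL. \<forall>f\<in>S. f A = 0})"

definition zariski :: "('a::field ^ 'n ^ 'n) topology" where
  "zariski = topology (\<lambda>U. U \<subseteq> carrier GL \<and> zariski_closed (carrier GL - U))"

lemma zariski_closed_carrier: "zariski_closed (carrier GL)"
  unfolding zariski_closed_def by (rule exI[of _ "{}"]) auto

lemma zariski_closed_empty: "zariski_closed {}"
  unfolding zariski_closed_def GL_regular_def
  by (rule exI[of _ "{\<lambda>_. 1}"]) (auto intro: function_algebra.const)

lemma zariski_closed_Un:
  assumes "zariski_closed Y" "zariski_closed Z"
  shows "zariski_closed (Y \<union> Z)"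
proof -
  obtain S T where S: "S \<subseteq> GL_regular" "Y = {A \<in> carrier GL. \<forall>f\<in>S. f A = 0}"
    and T: "T \<subseteq> GL_regular" "Z = {A \<in> carrier GL. \<forall>f\<in>T. f A = 0}"
    using assms unfolding zariski_closed_def by blast
  let ?P = "{h. \<exists>f\<in>S. \<exists>g\<in>T. h = (\<lambda>A. f A * g A)}"
  have "?P \<subseteq> GL_regular"
    using S(1) T(1) unfolding GL_regular_def by (auto intro!: function_algebra.mult)
  moreover have "Y \<union> Z = {A \<in> carrier GL. \<forall>h\<in>?P. h A = 0}"
    unfolding S(2) T(2) by (fastforce simp: mult_eq_0_iff)
  ultimately show ?thesis
    unfolding zariski_closed_def by blast
qed

lemma zariski_closed_Inter:
  fixes \<Z> :: "('a::field ^ 'n ^ 'n) set set"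
  assumes "\<And>Z. Z \<in> \<Z> \<Longrightarrow> zariski_closed Z"
  shows "zariski_closed (carrier GL \<inter> \<Inter>\<Z>)"
proof -
  define P where "P S Z \<longleftrightarrow> S \<subseteq> GL_regular \<and> Z = {A \<in> carrier GL. \<forall>f\<in>S. f A = 0}"
    for S and Z :: "('a ^ 'n ^ 'n) set"
  have "\<forall>Z\<in>\<Z>. \<exists>S. P S Z"
    using assms unfolding zariski_closed_def P_def by blast
  then obtain S where S: "\<forall>Z\<in>\<Z>. P (S Z) Z"
    by (rule bchoice[THEN exE])
  have "(\<Union>Z\<in>\<Z>. S Z) \<subseteq> GL_regular"
    using S unfolding P_def by blast
  moreover have "A \<in> Z \<longleftrightarrow> A \<in> carrier GL \<and> (\<forall>f\<in>S Z. f A = 0)" if "Z \<in> \<Z>" for A Z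
    using S that unfolding P_def by blast
  then have "carrier GL \<inter> \<Inter>\<Z> = {A \<in> carrier GL. \<forall>f\<in>(\<Union>Z\<in>\<Z>. S Z). f A = 0}"
    by (simp add: set_eq_iff) blast
  ultimately show ?thesis
    unfolding zariski_closed_def by blast
qed

lemma openin_zariski:
  fixes U :: "('a::field ^ 'n ^ 'n) set"
  shows "openin zariski U \<longleftrightarrow> U \<subseteq> carrier GL \<and> zariski_closed (carrier GL - U)"
proof -
  have "istopology (\<lambda>U :: ('a ^ 'n ^ 'n) set.
      U \<subseteq> carrier GL \<and> zariski_closed (carrier GL - U))"
    unfolding istopology_def
  proof (intro conjI allI impI)
    fix U V :: "('a ^ 'n ^ 'n) set"
    assume "U \<subseteq> carrier GL \<and> zariski_closed (carrier GL - U)"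
      "V \<subseteq> carrier GL \<and> zariski_closed (carrier GL - V)"
    then show "U \<inter> V \<subseteq> carrier GL" "zariski_closed (carrier GL - U \<inter> V)"
      by (auto simp: Diff_Int intro: zariski_closed_Un)
  next
    fix \<U> :: "('a ^ 'n ^ 'n) set set"
    assume *: "\<forall>U\<in>\<U>. U \<subseteq> carrier GL \<and> zariski_closed (carrier GL - U)"
    then show "\<Union>\<U> \<subseteq> carrier GL"
      by blast
    have "zariski_closed (carrier GL \<inter> \<Inter>((\<lambda>U. carrier GL - U) ` \<U>))"
      by (rule zariski_closed_Inter) (use * in auto)
    moreover have "carrier GL \<inter> \<Inter>((\<lambda>U. carrier GL - U) ` \<U>) = carrier GL - \<Union>\<U>"
      by blast
    ultimately show "zariski_closed (carrier GL - \<Union>\<U>)"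
      by simp
  qed
  then show ?thesis
    by (simp add: zariski_def topology_inverse')
qed

lemma topspace_zariski: "topspace zariski = carrier GL"
proof
  show "topspace zariski \<subseteq> carrier GL"
    unfolding topspace_def openin_zariski by blast
  show "carrier GL \<subseteq> topspace zariski"
    by (rule openin_subset) (simp add: openin_zariski zariski_closed_empty)
qed

lemma closedin_zariski: "closedin zariski Z \<longleftrightarrow> zariski_closed Z"
proof -
  have "Z \<subseteq> carrier GL" if "zariski_closed Z"
    using that unfolding zariski_closed_def by blast
  then show ?thesis
    unfolding closedin_def topspace_zariski openin_zariski
    by (auto simp: double_diff)
qed


subsection \<open>Linear algebraic groups\<close>

definition algebraic_group :: "('a::field ^ 'n ^ 'n) set \<Rightarrow> bool" where
  "algebraic_group G \<longleftrightarrow> subgroup G GL \<and> closedin zariski G"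

definition identity_component :: "('a::field ^ 'n ^ 'n) set \<Rightarrow> ('a ^ 'n ^ 'n) set" where
  "identity_component G = connected_component_of_set (subtopology zariski G) (mat 1)"

definition component_group :: "('a::field ^ 'n ^ 'n) set \<Rightarrow> ('a ^ 'n ^ 'n) set monoid" where
  "component_group G = GL\<lparr>carrier := G\<rparr> Mod identity_component G"

definition regular_map ::
  "'b set \<Rightarrow> ('b \<Rightarrow> 'a) set \<Rightarrow> 'c set \<Rightarrow> ('c \<Rightarrow> 'a) set \<Rightarrow> ('b \<Rightarrow> 'c) \<Rightarrow> bool" where
  "regular_map X \<O>X Y \<O>Y \<phi> \<longleftrightarrow>
     \<phi> \<in> X \<rightarrow> Y \<and> (\<forall>f\<in>\<O>Y. \<exists>g\<in>\<O>X. \<forall>x\<in>X. f (\<phi> x) = g x)"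

text \<open>Isomorphism of algebraic groups, not merely of abstract groups:\<close>

definition isomorphic_to_torus :: "('a::field ^ 'n ^ 'n) set \<Rightarrow> nat \<Rightarrow> bool" where
  "isomorphic_to_torus H m \<longleftrightarrow>
     (\<exists>\<phi> \<psi>. \<phi> \<in> iso (GL\<lparr>carrier := H\<rparr>) (torus m) \<and>
        regular_map H GL_regular (carrier (torus m)) (torus_regular m) \<phi> \<and>
        regular_map (carrier (torus m)) (torus_regular m) H GL_regular \<psi> \<and>
        (\<forall>A\<in>H. \<psi> (\<phi> A) = A) \<and> (\<forall>t\<in>carrier (torus m). \<phi> (\<psi> t) = t))"

definition irreducible_group :: "('a::field ^ 'n ^ 'n) set \<Rightarrow> bool" where
  "irreducible_group G \<longleftrightarrow>
     (\<forall>W. vec.subspace W \<and> (\<forall>A\<in>G. \<forall>w\<in>W. A *v w \<in> W) \<longrightarrow> W = {0} \<or> W = UNIV)"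

text \<open>The summands of the decomposition are required to be nonzero.\<close>

definition imprimitive_group :: "('a::field ^ 'n ^ 'n) set \<Rightarrow> bool" where
  "imprimitive_group G \<longleftrightarrow>
     (\<exists>k\<ge>2. \<exists>V :: nat \<Rightarrow> ('a ^ 'n) set.
        (\<forall>i<k. vec.subspace (V i) \<and> V i \<noteq> {0}) \<and>
        (\<forall>v. \<exists>!w. w \<in> (\<Pi>\<^sub>E i\<in>{..<k}. V i) \<and> v = (\<Sum>i<k. w i)) \<and>
        (\<forall>A\<in>G. \<exists>\<pi>. \<pi> permutes {..<k} \<and> (\<forall>i<k. (*v) A ` V i = V (\<pi> i))))"

end

(*
  A decomposition witnessing imprimitivity consists of n = dim lines, because n is prime and G
  permutes the summands transitively. In a basis adapted to it G is monomial, the connected group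
  H = G^0 is diagonal, and a generator g of G modulo H induces an n-cycle on the lines. The
  characters of the diagonal torus trivial on H form an ideal I of Z[z]/(z^n - 1), where z is
  conjugation by g; it is saturated since H is connected. If I is not contained in the ideal of
  Phi = 1 + z + ... + z^(n-1), then irreducibility of Phi puts z - 1 into I; so H is scalar and
  an eigenvector of g spans a G-invariant line, contradicting irreducibility. Otherwise I = 0 or
  I = (Phi), that is, H is the whole diagonal torus or its subgroup of determinant 1, as a closed
  subgroup of a torus is cut out by characters. The order of g modulo H is read off from: g^k is
  diagonal iff n divides k, and det(g)^k = 1 iff nu divides k.
*)
theory Submission
  imports Defs "HOL-Computational_Algebra.Polynomial_Factorial" "HOL-Algebra.Multiplicative_Group"
begin

text \<open>Irreducibility of Phi gives a Bezout identity only up to an integer, a * f + b * Phi = m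
  with m \<noteq> 0, because Z[z] is not a principal ideal domain. Multiplying by z - 1 turns Phi
  into z^n - 1, the zero of the character group, so m * (z - 1) lies in I; dividing by m is exactly
  saturation. Saturation in turn is connectedness: a character with trivial m-th power on H takes
  finitely many values there. Inside (Phi) all exponents collapse, since z * Phi = Phi modulo z^n -
  1: every character in I is a power of the determinant, and whether I is 0 or (Phi) depends only on
  whether det is 1 on H. This is decided by det(G): if det were 1 on H, then det(G) would consist of
  the powers of det(g), which cannot fill the units of an infinite field; if det(G) is finite,
  connectedness makes det constant on H. Algebraic closedness supplies the n-th root of the scalar
  g^n from which an eigenvector of g is built.\<close>

hide_const (open) up_ring.monom up_ring.coeff module.smult

subsection \<open>The cyclotomic polynomial of prime order\<close>

text \<open>Eisenstein's criterion. At the sum of the least indices where \<open>p\<close> fails to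
  divide a coefficient of \<open>a\<close> and of \<open>b\<close>, the product has a coefficient
  prime to \<open>p\<close>, so these indices are the two degrees. If both were positive,
  \<open>p\<close> would divide both constant coefficients.\<close>

lemma Eisenstein_degree:
  fixes a b :: "int poly" and p :: int
  assumes "prime p"
    and low: "\<And>i. i < degree (a * b) \<Longrightarrow> p dvd coeff (a * b) i"
    and lead: "\<not> p dvd lead_coeff (a * b)"
    and const: "\<not> p^2 dvd coeff (a * b) 0"
  shows "degree a = 0 \<or> degree b = 0"
proof (rule ccontr)
  assume deg: "\<not> (degree a = 0 \<or> degree b = 0)"
  have nz: "a \<noteq> 0" "b \<noteq> 0"
    using deg by auto
  have "\<not> p dvd lead_coeff a" "\<not> p dvd lead_coeff b"
    using lead by (auto simp: lead_coeff_mult)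
  then have ex: "\<exists>i. \<not> p dvd coeff a i" "\<exists>j. \<not> p dvd coeff b j"
    by blast+
  define i where "i = (LEAST i. \<not> p dvd coeff a i)"
  define j where "j = (LEAST j. \<not> p dvd coeff b j)"
  have i: "\<not> p dvd coeff a i" and i_min: "k < i \<Longrightarrow> p dvd coeff a k" for k
    unfolding i_def using LeastI_ex[OF ex(1)] not_less_Least by blast+
  have j: "\<not> p dvd coeff b j" and j_min: "k < j \<Longrightarrow> p dvd coeff b k" for k
    unfolding j_def using LeastI_ex[OF ex(2)] not_less_Least by blast+
  have "i \<le> degree a" "j \<le> degree b"
    using i j by (auto intro!: le_degree)
  have "coeff (a * b) (i + j) =
      coeff a i * coeff b j + (\<Sum>k\<in>{..i + j} - {i}. coeff a k * coeff b (i + j - k))"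
    by (simp add: coeff_mult sum.remove[of _ i])
  moreover have "p dvd (\<Sum>k\<in>{..i + j} - {i}. coeff a k * coeff b (i + j - k))"
  proof (rule dvd_sum)
    fix k assume "k \<in> {..i + j} - {i}"
    then have "k < i \<or> i + j - k < j"
      by auto
    then show "p dvd coeff a k * coeff b (i + j - k)"
      using i_min j_min by auto
  qed
  moreover have "\<not> p dvd coeff a i * coeff b j"
    using i j \<open>prime p\<close> by (simp add: prime_dvd_mult_iff)
  ultimately have "\<not> p dvd coeff (a * b) (i + j)"
    by (simp add: dvd_add_left_iff)
  then have "degree (a * b) \<le> i + j"
    using low by (meson not_le)
  then have "i = degree a" "j = degree b"
    using \<open>i \<le> degree a\<close> \<open>j \<le> degree b\<close> nz by (simp_all add: degree_mult_eq)
  then have "p dvd coeff a 0" "p dvd coeff b 0"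
    using deg i_min j_min by auto
  then have "p^2 dvd coeff (a * b) 0"
    by (simp add: coeff_mult power2_eq_square mult_dvd_mono)
  with const show False by simp
qed

text \<open>For prime \<open>n\<close> this is the \<open>n\<close>-th cyclotomic polynomial, the
  Phi of the overview. As an exponent it stands for the determinant.\<close>

definition geom_poly :: "nat \<Rightarrow> int poly" where
  "geom_poly n = (\<Sum>i<n. monom 1 i)"

lemma coeff_geom_poly: "coeff (geom_poly n) i = (if i < n then 1 else 0)"
  by (simp add: geom_poly_def coeff_sum)

lemma degree_geom_poly: "degree (geom_poly n) = n - 1"
proof (cases n)
  case (Suc m)
  then show ?thesis
    by (intro antisym degree_le le_degree) (auto simp: coeff_geom_poly)
qed (simp add: geom_poly_def)

lemma lead_coeff_geom_poly: "n > 0 \<Longrightarrow> lead_coeff (geom_poly n) = 1"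
  by (simp add: degree_geom_poly coeff_geom_poly)

lemma mult_geom_poly: "(monom 1 1 - 1) * geom_poly n = monom 1 n - 1"
  by (simp add: geom_poly_def monom_altdef[where c = 1] power_diff_1_eq)

lemma pcompose_pow: "pcompose (p ^ k) q = pcompose p q ^ k" for p q :: "'a::comm_semiring_1 poly"
  by (induction k) (auto simp: pcompose_mult pcompose_1)

text \<open>Substituting x + 1 for x in (x - 1) * Phi = x^n - 1 gives x * Phi(x + 1) = (x + 1)^n -
  1; the factor x accounts for the index \<open>Suc i\<close>. These coefficients are what
  Eisenstein's criterion needs.\<close>

lemma pcompose_geom_poly:
  assumes "n > 0"
  shows "coeff (pcompose (geom_poly n) [:1, 1:]) i = int (n choose (Suc i))"
proof -
  have "pcompose ((monom 1 1 - 1) * geom_poly n) [:1, 1:] = [:1, 1:] ^ n - 1"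
    unfolding mult_geom_poly
    by (simp add: pcompose_diff monom_altdef pcompose_pow pcompose_pCons pcompose_1)
  moreover have "pcompose ((monom 1 1 - 1) * geom_poly n) [:1, 1:]
      = monom 1 1 * pcompose (geom_poly n) [:1, 1:]"
    by (simp add: pcompose_mult pcompose_diff monom_altdef pcompose_pCons pcompose_1 one_pCons)
  ultimately have "coeff (monom 1 1 * pcompose (geom_poly n) [:1, 1:]) (Suc i)
      = coeff ([:1, 1:] ^ n - 1) (Suc i)"
    by (simp only:)
  then have "coeff (pcompose (geom_poly n) [:1, 1:]) i = coeff ([:1, 1:] ^ n) (Suc i)"
    by (simp add: monom_altdef coeff_1)
  moreover have "coeff ([:1, 1::int:] ^ n) k = int (n choose k)" for k
    by (cases "k \<le> n") (use coeff_linear_poly_power[of k n 1 1] in \<open>auto simp: coeff_eq_0 degree_linear_power\<close>)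
  ultimately show ?thesis
    by simp
qed

text \<open>Eisenstein at the prime \<open>n\<close> applies after the shift by 1, which preserves
  products and degrees: the shifted polynomial has leading coefficient 1, constant coefficient
  \<open>n\<close>, and binomial coefficients divisible by \<open>n\<close> in between. A constant
  factor is a unit because the leading coefficients of the two factors multiply to 1.\<close>

lemma prime_elem_geom_poly:
  assumes "prime n"
  shows "prime_elem (geom_poly n)"
proof -
  let ?s = "\<lambda>p :: int poly. pcompose p [:1, 1:]"
  have n: "n > 1"
    using assms by (rule prime_gt_1_nat)
  have deg: "degree (?s p) = degree p" for p :: "int poly"
    by (simp add: degree_pcompose)
  have "irreducible (geom_poly n)"
  proof (rule irreducibleI)
    show "geom_poly n \<noteq> 0"
      using lead_coeff_geom_poly[of n] n by auto
    show "\<not> is_unit (geom_poly n)"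
      using n by (auto simp: is_unit_poly_iff degree_geom_poly dest: arg_cong[where f = degree])
    fix a b assume ab: "geom_poly n = a * b"
    have sab: "?s a * ?s b = ?s (geom_poly n)"
      by (simp add: ab pcompose_mult)
    have "degree (?s a) = 0 \<or> degree (?s b) = 0"
    proof (rule Eisenstein_degree[where p = "int n"])
      show "prime (int n)"
        using assms by simp
      show "int n dvd coeff (?s a * ?s b) i" if "i < degree (?s a * ?s b)" for i
        using that n assms unfolding sab
        by (auto simp: deg degree_geom_poly pcompose_geom_poly intro!: dvd_choose_prime)
      show "\<not> int n dvd lead_coeff (?s a * ?s b)"
        using n unfolding sab by (simp add: deg degree_geom_poly pcompose_geom_poly)
      have "coeff (?s a * ?s b) 0 = int n"
        using n pcompose_geom_poly[of n 0] unfolding sab by simp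
      then show "\<not> int n ^ 2 dvd coeff (?s a * ?s b) 0"
        using n by (simp add: power2_eq_square flip: of_nat_mult)
    qed
    then have "degree a = 0 \<or> degree b = 0"
      by (simp only: deg)
    moreover have "lead_coeff a * lead_coeff b = 1"
      using lead_coeff_geom_poly[of n] n ab by (simp add: lead_coeff_mult)
    then have "is_unit (lead_coeff a)" "is_unit (lead_coeff b)"
      by (metis dvd_triv_left dvd_triv_right)+
    ultimately show "is_unit a \<or> is_unit b"
      by (auto simp: is_unit_poly_iff elim!: degree_eq_zeroE)
  qed
  then show ?thesis
    by (rule irreducible_imp_prime_elem_gcd)
qed

text \<open>Bezout over the rationals with denominators cleared. A nonzero element \<open>h\<close>
  of least degree in the ideal of \<open>f\<close> and \<open>p\<close> divides both up to integer
  factors, and primality of \<open>p\<close> leaves only a constant \<open>h\<close>.\<close>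

lemma prime_elem_bezout_const:
  fixes p f :: "int poly"
  assumes "prime_elem p" "lead_coeff p = 1" "\<not> p dvd f"
  obtains a b m where "m \<noteq> 0" "a * f + b * p = [:m:]"
proof -
  define J where "J = {h. h \<noteq> 0 \<and> (\<exists>a b. h = a * f + b * p)}"
  have "f \<in> J"
  proof -
    have "f = 1 * f + 0 * p" "f \<noteq> 0"
      using assms(3) by auto
    then show ?thesis
      unfolding J_def by blast
  qed
  then obtain h where h: "h \<in> J" and min: "\<And>h'. h' \<in> J \<Longrightarrow> degree h \<le> degree h'"
    using ex_has_least_nat[of "\<lambda>h. h \<in> J" f degree] by blast
  obtain a b where ab: "h = a * f + b * p" and "h \<noteq> 0"
    using h unfolding J_def by blast
  \<comment> \<open>The remainder of a pseudo-division by \<open>h\<close> stays in the ideal and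
    has smaller degree than \<open>h\<close>, so it vanishes.\<close>
  have dvd: "\<exists>q c. c \<noteq> 0 \<and> smult c g = h * q" if g: "g = a' * f + b' * p" for g a' b'
  proof -
    obtain q r where qr: "pseudo_divmod g h = (q, r)"
      by fastforce
    let ?c = "lead_coeff h ^ (Suc (degree g) - degree h)"
    have *: "smult ?c g = h * q + r" "r = 0 \<or> degree r < degree h"
      using pseudo_divmod[OF \<open>h \<noteq> 0\<close> qr] by auto
    have "r = smult ?c g - h * q"
      using * by simp
    also have "\<dots> = (smult ?c a' - a * q) * f + (smult ?c b' - b * q) * p"
      by (simp add: g ab algebra_simps smult_add_right)
    finally have r: "r = \<dots>" .
    have "r = 0"
    proof (rule ccontr)
      assume "r \<noteq> 0"
      then have "r \<in> J"
        using r unfolding J_def by blast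
      with min *(2) \<open>r \<noteq> 0\<close> show False
        by fastforce
    qed
    then show ?thesis
      using * \<open>h \<noteq> 0\<close> by (intro exI[of _ q] exI[of _ ?c]) simp
  qed
  have "\<exists>q c. c \<noteq> 0 \<and> smult c p = h * q"
    by (rule dvd[of _ 0 1]) simp
  then obtain q c where q: "c \<noteq> 0" "smult c p = h * q"
    by blast
  then have "p dvd h * q"
    by (metis dvd_refl dvd_smult)
  then have "p dvd h \<or> p dvd q"
    using assms(1) by (simp add: prime_elem_dvd_mult_iff)
  then show thesis
  proof
    \<comment> \<open>Cancelling \<open>p\<close> shows that \<open>h\<close> divides a nonzero
      constant.\<close>
    assume "p dvd q"
    then obtain q' where "q = p * q'" ..
    then have "p * [:c:] = p * (h * q')"
      using q by (simp add: ac_simps)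
    then have "[:c:] = h * q'"
      using assms(1) by (metis mult_left_cancel prime_elem_not_zeroI)
    then have "degree h = 0"
      using q(1) by (metis degree_mult_eq_0 degree_pCons_0 mult_eq_0_iff pCons_eq_0_iff)
    then obtain m where "h = [:m:]"
      by (rule degree_eq_zeroE)
    with ab \<open>h \<noteq> 0\<close> show thesis
      by (intro that[of m a b]) auto
  next
    \<comment> \<open>Here \<open>p\<close> divides an integer multiple of \<open>f\<close>, hence
      that integer, so \<open>p\<close> is constant; being monic it is 1, against
      \<open>\<not> p dvd f\<close>.\<close>
    assume "p dvd h"
    have "\<exists>q c. c \<noteq> 0 \<and> smult c f = h * q"
      by (rule dvd[of _ 1 0]) simp
    then obtain q c where q: "c \<noteq> 0" "smult c f = h * q"
      by blast
    then have "p dvd [:c:] * f"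
      using \<open>p dvd h\<close> by simp
    then have "p dvd [:c:]"
      using assms by (simp add: prime_elem_dvd_mult_iff del: mult_pCons_left)
    then obtain k where k: "[:c:] = p * k" ..
    then have "degree p = 0"
      using q(1) by (metis degree_mult_eq_0 degree_pCons_0 mult_eq_0_iff pCons_eq_0_iff)
    then obtain e where "p = [:e:]"
      by (rule degree_eq_zeroE)
    with assms(2) have "p = 1"
      by (simp add: one_pCons)
    with assms(3) show thesis by simp
  qed
qed

subsection \<open>Characters with exponents given by an integer polynomial\<close>

text \<open>
  The character group of the torus of \<open>n\<close>-periodic sequences is \<open>\<int>[z]/(z\<^sup>n - 1)\<close>; using arbitrary
  polynomials as exponents, the cyclic shift of the sequence becomes multiplication by \<open>z\<close>.
\<close>

definition lchar :: "int poly \<Rightarrow> (nat \<Rightarrow> 'a::field) \<Rightarrow> 'a" where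
  "lchar f u = (\<Prod>i\<le>degree f. u i powi coeff f i)"

lemma lchar_eq_prod: "degree f \<le> N \<Longrightarrow> lchar f u = (\<Prod>i\<le>N. u i powi coeff f i)"
  unfolding lchar_def by (rule prod.mono_neutral_left) (auto simp: coeff_eq_0)

lemma lchar_0 [simp]: "lchar 0 u = 1"
  by (simp add: lchar_def)

lemma lchar_add:
  assumes "\<And>i. u i \<noteq> 0"
  shows "lchar (f + g) u = lchar f u * lchar g u"
proof -
  let ?N = "max (degree f) (degree g)"
  have "lchar (f + g) u = (\<Prod>i\<le>?N. u i powi coeff (f + g) i)"
    by (rule lchar_eq_prod) (rule degree_add_le_max)
  also have "\<dots> = lchar f u * lchar g u"
    using assms by (simp add: lchar_eq_prod[of _ ?N] power_int_add flip: prod.distrib)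
  finally show ?thesis .
qed

lemma lchar_nonzero: "(\<And>i. u i \<noteq> 0) \<Longrightarrow> lchar f u \<noteq> 0"
  by (simp add: lchar_def)

lemma lchar_mult_seq: "lchar f (\<lambda>i. u i * v i) = lchar f u * lchar f v"
  by (simp add: lchar_def power_int_mult_distrib prod.distrib)

lemma lchar_one_seq [simp]: "lchar f (\<lambda>i. 1) = 1"
  by (simp add: lchar_def)

lemma lchar_uminus: "lchar (- f) u = inverse (lchar f u)"
  by (simp add: lchar_def power_int_minus flip: prod_inversef)

lemma lchar_diff:
  assumes "\<And>i. u i \<noteq> 0"
  shows "lchar (f - g) u = lchar f u / lchar g u"
  using lchar_add[of u f "- g"] assms by (simp add: lchar_uminus field_simps)

lemma prod_powi: "(\<Prod>i\<in>A. f i) powi (m::int) = (\<Prod>i\<in>A. f i powi m)" for f :: "_ \<Rightarrow> 'a::field"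
  by (induction A rule: infinite_finite_induct) (auto simp: power_int_mult_distrib)

lemma lchar_smult:
  "lchar (smult m f) u = lchar f u powi m"
proof -
  have "lchar (smult m f) u = (\<Prod>i\<le>degree f. u i powi coeff (smult m f) i)"
    by (rule lchar_eq_prod) (rule degree_smult_le)
  then show ?thesis
    by (simp only: lchar_def prod_powi coeff_smult mult.commute[of m] power_int_mult)
qed

lemma lchar_pCons_0: "lchar (pCons 0 f) u = lchar f (\<lambda>i. u (Suc i))"
proof -
  have "lchar (pCons 0 f) u = (\<Prod>i\<le>Suc (degree f). u i powi coeff (pCons 0 f) i)"
    by (rule lchar_eq_prod) (rule degree_pCons_le)
  then show ?thesis
    unfolding lchar_def prod.atMost_Suc_shift by simp
qed

lemma lchar_monom [simp]: "lchar (monom 1 k) u = u k"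
proof -
  have "lchar (monom 1 k) u = (\<Prod>i\<le>k. u i powi coeff (monom 1 k) i)"
    by (rule lchar_eq_prod) (rule degree_monom_le)
  also have "\<dots> = (\<Prod>i\<in>{k}. u i powi coeff (monom 1 k) i)"
    by (rule prod.mono_neutral_right) auto
  finally show ?thesis by simp
qed

lemma lchar_1 [simp]: "lchar 1 u = u 0"
  using lchar_monom[of 0 u] by simp

lemma lchar_geom_poly: "lchar (geom_poly n) u = (\<Prod>i<n. u i)"
proof (cases n)
  case (Suc m)
  then show ?thesis
    by (auto simp: lchar_def degree_geom_poly coeff_geom_poly lessThan_Suc_atMost intro!: prod.cong)
qed (simp add: geom_poly_def)

lemma prod_periodic_shift:
  fixes u :: "nat \<Rightarrow> 'a::field"
  assumes "u n = u 0"
  shows "(\<Prod>i<n. u (Suc i)) = (\<Prod>i<n. u i)"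
proof (cases n)
  case (Suc m)
  have "(\<Prod>i<n. u (Suc i)) = (\<Prod>i<m. u (Suc i)) * u 0"
    using assms by (simp add: Suc)
  also have "\<dots> = (\<Prod>i<n. u i)"
    unfolding Suc prod.lessThan_Suc_shift by (simp add: mult.commute)
  finally show ?thesis .
qed simp

text \<open>On periodic sequences z acts trivially on Phi, so \<open>q\<close> may be replaced by
  its value at z = 1.\<close>

lemma lchar_geom_poly_mult:
  assumes "\<And>i. u i \<noteq> 0" "\<And>i. u (i + n) = u i"
  shows "lchar (geom_poly n * q) u = (\<Prod>i<n. u i) powi (poly q 1)"
  using assms
proof (induction q arbitrary: u)
  case (pCons a q)
  have "(\<Prod>i<n. u (Suc i)) = (\<Prod>i<n. u i)"
    using pCons.prems(2)[of 0] by (simp add: prod_periodic_shift)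
  moreover have "lchar (geom_poly n * q) (\<lambda>i. u (Suc i)) = (\<Prod>i<n. u (Suc i)) powi (poly q 1)"
    by (rule pCons.IH) (use pCons.prems in \<open>auto simp flip: add_Suc\<close>)
  ultimately show ?case
    using pCons.prems
    by (simp add: lchar_add lchar_smult lchar_pCons_0 lchar_geom_poly power_int_add)
qed simp

text \<open>Isolates what is used of the sequences of diagonal entries of matrices in H:
  \<open>periodic\<close> since the indices run along an \<open>n\<close>-cycle,
  \<open>shift\<close> for conjugation by the generator, \<open>saturated\<close> for connectedness,
  \<open>nonconstant\<close> for H not being scalar.\<close>

locale shift_invariant_family =
  fixes U :: "(nat \<Rightarrow> 'a::field) set" and n :: nat
  assumes prime_n: "prime n"
    and nonzero: "u \<in> U \<Longrightarrow> u i \<noteq> 0"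
    and periodic: "u \<in> U \<Longrightarrow> u (i + n) = u i"
    and shift: "u \<in> U \<Longrightarrow> (\<lambda>i. u (Suc i)) \<in> U"
    and saturated: "m > 0 \<Longrightarrow> (\<And>u. u \<in> U \<Longrightarrow> lchar f u ^ m = 1) \<Longrightarrow> u \<in> U \<Longrightarrow> lchar f u = 1"
    and nonconstant: "\<exists>u\<in>U. u (Suc 0) \<noteq> u 0"
begin

text \<open>The ideal I of the overview, pulled back to Z[z]; thus it contains z^n - 1.\<close>

definition ann :: "int poly set" where
  "ann = {f. \<forall>u\<in>U. lchar f u = 1}"

text \<open>Multiplying the exponent by z amounts to evaluating at the shifted sequence, which is
  again in \<open>U\<close>.\<close>

lemma ann_mult: "f \<in> ann \<Longrightarrow> g * f \<in> ann"
proof (induction g)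
  case (pCons a g)
  then show ?case
    using nonzero shift by (auto simp: ann_def lchar_add lchar_smult lchar_pCons_0)
qed (simp add: ann_def)

lemma ann_add: "f \<in> ann \<Longrightarrow> g \<in> ann \<Longrightarrow> f + g \<in> ann"
  using nonzero by (simp add: ann_def lchar_add)

lemma ann_saturated:
  assumes "smult m f \<in> ann" "m \<noteq> 0"
  shows "f \<in> ann"
proof -
  have "lchar f u ^ nat \<bar>m\<bar> = 1" if "u \<in> U" for u
  proof -
    have "lchar f u powi m = 1"
      using assms(1) that by (simp add: ann_def lchar_smult)
    then show ?thesis
      by (cases "m \<ge> 0") (auto simp: power_int_def power_inverse)
  qed
  then show ?thesis
    using saturated[of "nat \<bar>m\<bar>" f] assms(2) unfolding ann_def by simp
qed

text \<open>Otherwise Bezout, multiplied by z - 1, and saturation put z - 1 into \<open>ann\<close>;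
  then \<open>u 1 = u 0\<close> throughout \<open>U\<close>, against
  \<open>nonconstant\<close>.\<close>

lemma ann_dvd:
  assumes "f \<in> ann"
  shows "geom_poly n dvd f"
proof (rule ccontr)
  assume ndvd: "\<not> geom_poly n dvd f"
  have lead: "lead_coeff (geom_poly n) = 1"
    using prime_n by (simp add: lead_coeff_geom_poly prime_gt_0_nat)
  obtain a b m where m: "m \<noteq> 0" "a * f + b * geom_poly n = [:m:]"
    by (rule prime_elem_bezout_const[OF prime_elem_geom_poly[OF prime_n] lead ndvd])
  have "smult m (monom 1 1 - 1) = (monom 1 1 - 1) * (a * f + b * geom_poly n)"
    unfolding m by simp
  also have "\<dots> = ((monom 1 1 - 1) * a) * f + b * (monom 1 n - 1)"
    unfolding mult_geom_poly[of n, symmetric] by (simp only: ring_distribs ac_simps)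
  also have "\<dots> \<in> ann"
  proof (intro ann_add ann_mult assms)
    show "monom 1 n - 1 \<in> ann"
      using nonzero periodic[of _ 0] by (simp add: ann_def lchar_diff)
  qed
  finally have "monom 1 1 - 1 \<in> ann"
    using m(1) ann_saturated by blast
  then have "\<forall>u\<in>U. u 1 / u 0 = 1"
    using nonzero by (simp add: ann_def lchar_diff)
  then show False
    using nonconstant nonzero by (force simp: divide_eq_1_iff)
qed

text \<open>The exponent is a multiple of Phi, so the character is a power of the product over one
  period. The point is that \<open>t\<close> may lie outside \<open>U\<close>.\<close>

lemma ann_trivial_prod_1:
  assumes "f \<in> ann" "\<And>i. t i \<noteq> 0" "\<And>i. t (i + n) = t i" "(\<Prod>i<n. t i) = 1"
  shows "lchar f t = 1"
  using ann_dvd[OF assms(1)] lchar_geom_poly_mult[of t n] assms by (auto elim!: dvdE)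

text \<open>With f = Phi * q, the character of \<open>f\<close> is the power of the product over a
  period with exponent q(1), so q(1) * Phi lies in \<open>ann\<close>. As Phi itself does not,
  saturation forces q(1) = 0, and \<open>f\<close> is trivial on every periodic sequence.\<close>

lemma ann_trivial:
  assumes "\<exists>u\<in>U. (\<Prod>i<n. u i) \<noteq> 1"
    and "f \<in> ann" "\<And>i. t i \<noteq> 0" "\<And>i. t (i + n) = t i"
  shows "lchar f t = 1"
proof -
  obtain q where q: "f = geom_poly n * q"
    using ann_dvd[OF assms(2)] by (auto elim: dvdE)
  have "smult (poly q 1) (geom_poly n) \<in> ann"
    using assms(2) nonzero periodic
    by (simp add: q ann_def lchar_geom_poly_mult lchar_smult lchar_geom_poly)
  moreover have "geom_poly n \<notin> ann"
    using assms(1) by (auto simp: ann_def lchar_geom_poly)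
  ultimately have "poly q 1 = 0"
    using ann_saturated by blast
  then show ?thesis
    using lchar_geom_poly_mult[of t n q] assms by (simp add: q)
qed

end

subsection \<open>Cyclic groups\<close>

lemma (in group) cyclic_iso_integer_mod_group:
  assumes "x \<in> carrier G" "carrier G = range (\<lambda>k::int. x [^] k)"
    and ord: "\<And>k::nat. x [^] k = \<one> \<longleftrightarrow> N dvd k" and "N > 0"
  shows "G \<cong> integer_mod_group N"
proof -
  have N: "ord x = N"
    using pow_eq_id[OF assms(1)] ord by (metis dvd_antisym dvd_refl)
  have eq: "x [^] a = x [^] b \<longleftrightarrow> a mod int N = b mod int N" for a b :: int
    using int_pow_eq[OF assms(1), of a b] by (auto simp: N mod_eq_dvd_iff dvd_diff_commute)
  have "(\<lambda>k::int. x [^] k) \<in> iso (integer_mod_group N) G"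
    unfolding iso_def
  proof (intro CollectI conjI)
    show "(\<lambda>k::int. x [^] k) \<in> hom (integer_mod_group N) G"
      using assms(1) eq by (auto simp: hom_def int_pow_mult[symmetric])
    show "bij_betw (\<lambda>k::int. x [^] k) (carrier (integer_mod_group N)) (carrier G)"
      unfolding bij_betw_def
    proof
      show "inj_on (\<lambda>k::int. x [^] k) (carrier (integer_mod_group N))"
        using \<open>N > 0\<close> by (auto simp: inj_on_def eq carrier_integer_mod_group)
      have "x [^] k = x [^] (k mod int N)" for k :: int
        by (simp add: eq)
      moreover have "k mod int N \<in> carrier (integer_mod_group N)" for k
        using \<open>N > 0\<close> by (simp add: carrier_integer_mod_group)
      ultimately show "(\<lambda>k::int. x [^] k) ` carrier (integer_mod_group N) = carrier G"
        unfolding assms(2) by blast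
    qed
  qed
  then have "integer_mod_group N \<cong> G"
    by (auto simp: is_iso_def)
  then show ?thesis
    by (simp add: group.iso_sym)
qed

subsection \<open>The general linear group and its regular functions\<close>

lemma carrier_GL [simp]: "carrier GL = {A. invertible A}"
  and mult_GL [simp]: "A \<otimes>\<^bsub>GL\<^esub> B = A ** B"
  and one_GL [simp]: "\<one>\<^bsub>GL\<^esub> = mat 1"
  by (simp_all add: GL_def)

lemma matrix_inv_invertible:
  fixes A :: "'a::field ^ 'n ^ 'n"
  assumes "invertible A"
  shows "A ** matrix_inv A = mat 1" "matrix_inv A ** A = mat 1" "invertible (matrix_inv A)"
proof -
  have "A ** matrix_inv A = mat 1 \<and> matrix_inv A ** A = mat 1"
    unfolding matrix_inv_def by (rule someI_ex) (use assms in \<open>auto simp: invertible_def\<close>)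
  then show "A ** matrix_inv A = mat 1" "matrix_inv A ** A = mat 1" "invertible (matrix_inv A)"
    unfolding invertible_def by blast+
qed

lemma group_GL: "group (GL :: ('a::field ^ 'n ^ 'n) monoid)"
proof (rule groupI)
  show "\<exists>B\<in>carrier GL. B \<otimes>\<^bsub>GL\<^esub> A = \<one>\<^bsub>GL\<^esub>" if "A \<in> carrier GL" for A :: "'a ^ 'n ^ 'n"
    using that matrix_inv_invertible by auto
  show "\<one>\<^bsub>GL\<^esub> \<in> carrier (GL :: ('a ^ 'n ^ 'n) monoid)"
    by (auto simp: invertible_def)
qed (simp_all add: invertible_mult matrix_mul_assoc)

lemma inv_GL:
  fixes A :: "'a::field ^ 'n ^ 'n"
  assumes "invertible A"
  shows "inv\<^bsub>GL\<^esub> A = matrix_inv A"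
  using assms group.inv_equality[OF group_GL, of "matrix_inv A" A]
  by (simp add: matrix_inv_invertible)

lemma matrix_inv_inv:
  fixes A :: "'a::field ^ 'n ^ 'n"
  shows "invertible A \<Longrightarrow> matrix_inv (matrix_inv A) = A"
  using group.inv_inv[OF group_GL, of A] by (simp add: inv_GL matrix_inv_invertible)

lemma GL_regular_entry: "(\<lambda>A. A $ i $ j) \<in> GL_regular"
  unfolding GL_regular_def by (rule function_algebra.gen) auto

lemma GL_regular_inverse_det: "(\<lambda>A. inverse (det A)) \<in> GL_regular"
  unfolding GL_regular_def by (rule function_algebra.gen) auto

lemma GL_regular_const: "(\<lambda>A. c) \<in> GL_regular"
  unfolding GL_regular_def by (rule function_algebra.const)

lemma GL_regular_add: "f \<in> GL_regular \<Longrightarrow> g \<in> GL_regular \<Longrightarrow> (\<lambda>A. f A + g A) \<in> GL_regular"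
  and GL_regular_mult: "f \<in> GL_regular \<Longrightarrow> g \<in> GL_regular \<Longrightarrow> (\<lambda>A. f A * g A) \<in> GL_regular"
  unfolding GL_regular_def by (rule function_algebra.add function_algebra.mult; assumption)+

lemma GL_regular_diff_const:
  assumes "f \<in> GL_regular"
  shows "(\<lambda>A. f A - c) \<in> GL_regular"
  using GL_regular_add[OF assms GL_regular_const[of "- c"]] by simp

lemma GL_regular_sum:
  "(\<And>i. i \<in> I \<Longrightarrow> f i \<in> GL_regular) \<Longrightarrow> (\<lambda>A. \<Sum>i\<in>I. f i A) \<in> GL_regular"
  by (induction I rule: infinite_finite_induct) (auto intro!: GL_regular_const GL_regular_add)

lemma GL_regular_prod:
  "(\<And>i. i \<in> I \<Longrightarrow> f i \<in> GL_regular) \<Longrightarrow> (\<lambda>A. \<Prod>i\<in>I. f i A) \<in> GL_regular"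
  by (induction I rule: infinite_finite_induct) (auto intro!: GL_regular_const GL_regular_mult)

lemma GL_regular_power: "f \<in> GL_regular \<Longrightarrow> (\<lambda>A. f A ^ k) \<in> GL_regular"
  by (induction k) (auto intro!: GL_regular_const GL_regular_mult)

lemma GL_regular_det: "det \<in> GL_regular"
proof -
  have "(\<lambda>A. \<Sum>p\<in>{p. p permutes UNIV}. of_int (sign p) * (\<Prod>i\<in>UNIV. A $ i $ p i)) \<in> GL_regular"
    by (intro GL_regular_sum GL_regular_mult GL_regular_prod GL_regular_const GL_regular_entry)
  then show ?thesis
    unfolding det_def[abs_def] .
qed

lemma GL_regular_entry_mult2: "(\<lambda>A. (B ** A ** C) $ i $ j) \<in> GL_regular"
  unfolding matrix_matrix_mult_def vec_lambda_beta
  by (intro GL_regular_sum GL_regular_mult GL_regular_const GL_regular_entry)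

lemma GL_regular_mult2:
  fixes B C :: "'a::field ^ 'n ^ 'n"
  assumes "f \<in> GL_regular"
  shows "(\<lambda>A. f (B ** A ** C)) \<in> GL_regular"
  using assms unfolding GL_regular_def
proof (induction f rule: function_algebra.induct)
  case (gen f)
  then show ?case
  proof
    assume "f = (\<lambda>A. inverse (det A))"
    then have "(\<lambda>A. f (B ** A ** C)) = (\<lambda>A. inverse (det B) * inverse (det A) * inverse (det C))"
      by (simp add: det_mul fun_eq_iff)
    then show ?thesis
      unfolding GL_regular_def[symmetric]
      by (simp only:) (intro GL_regular_mult GL_regular_const GL_regular_inverse_det)
  next
    assume "f \<in> {f. \<exists>i j. f = (\<lambda>A. A $ i $ j)}"
    then show ?thesis
      unfolding GL_regular_def[symmetric] using GL_regular_entry_mult2 by blast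
  qed
qed (auto intro: function_algebra.intros)

lemma zariski_closed_zero_set: "f \<in> GL_regular \<Longrightarrow> zariski_closed {A \<in> carrier GL. f A = 0}"
  unfolding zariski_closed_def by (rule exI[of _ "{f}"]) auto

text \<open>Independent factors on the two sides cover translations and conjugations at
  once.\<close>

lemma continuous_map_mult2:
  fixes B C :: "'a::field ^ 'n ^ 'n"
  assumes "invertible B" "invertible C"
  shows "continuous_map zariski zariski (\<lambda>A. B ** A ** C)"
  unfolding continuous_map_closedin topspace_zariski closedin_zariski
proof (intro conjI ballI allI impI)
  show "(\<lambda>A. B ** A ** C) \<in> carrier GL \<rightarrow> carrier GL"
    using assms by (auto simp: invertible_mult)
  fix Z :: "('a ^ 'n ^ 'n) set" assume "zariski_closed Z"
  then obtain S where S: "S \<subseteq> GL_regular" "Z = {A \<in> carrier GL. \<forall>f\<in>S. f A = 0}"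
    unfolding zariski_closed_def by blast
  let ?S = "(\<lambda>f A. f (B ** A ** C)) ` S"
  have "?S \<subseteq> GL_regular"
    using S(1) GL_regular_mult2 by blast
  moreover have "{A \<in> carrier GL. B ** A ** C \<in> Z} = {A \<in> carrier GL. \<forall>f\<in>?S. f A = 0}"
    unfolding S(2) using assms by (auto simp: invertible_mult)
  ultimately show "zariski_closed {A \<in> carrier GL. B ** A ** C \<in> Z}"
    unfolding zariski_closed_def by blast
qed

subsection \<open>The identity component\<close>

text \<open>The fibre over \<open>f A\<close> is closed, and so is the union of the remaining
  fibres, being the zero set of a finite product of functions \<open>f - c\<close>. The two separate
  \<open>H\<close> unless the second is empty on \<open>H\<close>.\<close>

lemma connectedin_finite_image:
  assumes "connectedin zariski H" "f \<in> GL_regular" "finite (f ` H)" "A \<in> H" "B \<in> H"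
  shows "f A = f B"
proof (rule ccontr)
  assume ne: "f A \<noteq> f B"
  let ?E1 = "{X \<in> carrier GL. f X - f A = 0}"
  let ?E2 = "{X \<in> carrier GL. (\<Prod>c\<in>f ` H - {f A}. f X - c) = 0}"
  have H: "H \<subseteq> carrier GL"
    using assms(1) unfolding connectedin_def topspace_zariski by blast
  have "closedin zariski ?E1" "closedin zariski ?E2"
    unfolding closedin_zariski
    by (intro zariski_closed_zero_set GL_regular_diff_const GL_regular_prod assms(2))+
  moreover have "H \<subseteq> ?E1 \<union> ?E2" "?E1 \<inter> ?E2 \<inter> H = {}" "?E1 \<inter> H \<noteq> {}" "?E2 \<inter> H \<noteq> {}"
    using H assms ne by (auto simp: prod_zero_iff)
  ultimately show False
    using assms(1) unfolding connectedin_closedin by blast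
qed

lemma finite_roots_of_unity:
  assumes "m > 0"
  shows "finite {x::'a::field. x ^ m = 1}"
proof -
  have "coeff (monom (1::'a) m - 1) m = 1"
    using assms by (simp add: coeff_1)
  then have "monom (1::'a) m - 1 \<noteq> 0"
    by (metis coeff_0 zero_neq_one)
  from poly_roots_finite[OF this] show ?thesis
    by (simp add: poly_monom)
qed

text \<open>The values of \<open>f\<close> on \<open>H\<close> are \<open>m\<close>-th roots of
  unity, hence finite in number. This is the source of saturation.\<close>

lemma connectedin_power_eq_1:
  fixes f :: "'a::field ^ 'n ^ 'n \<Rightarrow> 'a"
  assumes "connectedin zariski H" "f \<in> GL_regular" "m > 0" "\<And>A. A \<in> H \<Longrightarrow> f A ^ m = 1"
    and "B \<in> H" "f B = 1" "A \<in> H"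
  shows "f A = 1"
proof -
  have "f ` H \<subseteq> {x. x ^ m = 1}"
    using assms by auto
  then show ?thesis
    using connectedin_finite_image[OF assms(1,2)] finite_roots_of_unity[OF \<open>m > 0\<close>] assms(5-7)
    by (metis finite_subset)
qed

locale linear_algebraic_group =
  fixes G :: "('a::field ^ 'n ^ 'n) set"
  assumes algebraic: "algebraic_group G"
begin

abbreviation H where "H \<equiv> identity_component G"

lemma subgroup_G: "subgroup G GL" and closed_G: "closedin zariski G"
  using algebraic by (auto simp: algebraic_group_def)

lemma invertible_G: "A \<in> G \<Longrightarrow> invertible A"
  using subgroup.subset[OF subgroup_G] by auto

lemma one_in_G: "mat 1 \<in> G"
  using subgroup.one_closed[OF subgroup_G] by simp

lemma mult_in_G: "A \<in> G \<Longrightarrow> B \<in> G \<Longrightarrow> A ** B \<in> G"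
  using subgroup.m_closed[OF subgroup_G] by simp

lemma inv_in_G: "A \<in> G \<Longrightarrow> matrix_inv A \<in> G"
  using subgroup.m_inv_closed[OF subgroup_G] inv_GL invertible_G by metis

lemma connected_H: "connectedin zariski H" and H_subset: "H \<subseteq> G"
  using connectedin_connected_component_of[of "subtopology zariski G" "mat 1"]
  unfolding identity_component_def by (auto simp: connectedin_subtopology)

lemma one_in_H: "mat 1 \<in> H"
  using one_in_G invertible_G
  by (simp add: identity_component_def connected_component_of_refl topspace_subtopology
      topspace_zariski)

lemma subset_H: "connectedin zariski S \<Longrightarrow> S \<subseteq> G \<Longrightarrow> mat 1 \<in> S \<Longrightarrow> S \<subseteq> H"
  unfolding identity_component_def
  by (rule connected_component_of_maximal) (auto simp: connectedin_subtopology)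

lemma closed_H: "zariski_closed H"
  using closedin_connected_component_of[of "subtopology zariski G"] closed_G
  unfolding identity_component_def closedin_zariski[symmetric]
  by (rule closedin_trans_full)

text \<open>The image of \<open>H\<close> is connected, lies in \<open>G\<close>, and contains the
  identity because of \<open>A0\<close>, so it stays in the identity component.\<close>

lemma mult2_in_H:
  assumes "B \<in> G" "C \<in> G" "A0 \<in> H" "B ** A0 ** C = mat 1" "A \<in> H"
  shows "B ** A ** C \<in> H"
proof -
  have "(\<lambda>A. B ** A ** C) ` H \<subseteq> H"
  proof (rule subset_H)
    show "connectedin zariski ((\<lambda>A. B ** A ** C) ` H)"
      using connectedin_continuous_map_image[OF continuous_map_mult2 connected_H] assms invertible_G
      by blast
    show "(\<lambda>A. B ** A ** C) ` H \<subseteq> G"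
      using assms H_subset by (auto intro!: mult_in_G)
    show "mat 1 \<in> (\<lambda>A. B ** A ** C) ` H"
      using assms by force
  qed
  with assms show ?thesis by blast
qed

text \<open>
  Closure of \<open>H\<close> under inverses comes from left translations alone, so the Zariski continuity of
  inversion is never used.
\<close>

lemma inv_mult_in_H: "A \<in> H \<Longrightarrow> B \<in> H \<Longrightarrow> matrix_inv A ** B \<in> H"
  using mult2_in_H[of "matrix_inv A" "mat 1" A B] H_subset
  by (auto simp: inv_in_G one_in_G matrix_inv_invertible invertible_G)

lemma inv_in_H: "A \<in> H \<Longrightarrow> matrix_inv A \<in> H"
  using inv_mult_in_H[of A "mat 1"] one_in_H by simp

lemma mult_in_H: "A \<in> H \<Longrightarrow> B \<in> H \<Longrightarrow> A ** B \<in> H"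
  using inv_mult_in_H[of "matrix_inv A" B] inv_in_H H_subset
  by (auto simp: matrix_inv_inv invertible_G)

lemma conj_in_H: "B \<in> G \<Longrightarrow> A \<in> H \<Longrightarrow> B ** A ** matrix_inv B \<in> H"
  using mult2_in_H[of B "matrix_inv B" "mat 1" A] one_in_H
  by (simp add: inv_in_G matrix_inv_invertible invertible_G)

lemma normal_H: "H \<lhd> GL\<lparr>carrier := G\<rparr>"
proof -
  interpret GL: group "GL :: ('a ^ 'n ^ 'n) monoid"
    by (rule group_GL)
  have G: "group (GL\<lparr>carrier := G\<rparr>)"
    using subgroup_G by (rule GL.subgroup_imp_group)
  have "subgroup H GL"
    using H_subset one_in_H mult_in_H inv_in_H
    by (intro GL.subgroupI) (auto simp: inv_GL invertible_G)
  then have "subgroup H (GL\<lparr>carrier := G\<rparr>)"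
    using subgroup_G H_subset by (rule GL.subgroup_incl)
  moreover have "inv\<^bsub>GL\<lparr>carrier := G\<rparr>\<^esub> B = matrix_inv B" if "B \<in> G" for B
    using GL.m_inv_consistent[OF subgroup_G that] that by (simp add: inv_GL invertible_G)
  ultimately show ?thesis
    using conj_in_H by (auto simp: group.normal_inv_iff[OF G])
qed

end

locale cyclic_component_group = linear_algebraic_group G
  for G :: "('a::field ^ 'n ^ 'n) set" +
  assumes finite_index: "finite (carrier (component_group G))"
    and cyclic: "cyclic_group (component_group G)"
begin

text \<open>Lifts a generator of the cyclic quotient to a matrix. The last clause reduces the
  structure of the quotient to the question which powers of \<open>g\<close> lie in
  \<open>H\<close>.\<close>

lemma component_generator:
  obtains g where "g \<in> G"
    and "\<And>A. A \<in> G \<Longrightarrow> \<exists>h\<in>H. \<exists>k::nat. A = h ** (g [^]\<^bsub>GL\<^esub> k)"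
    and "\<And>N. N > 0 \<Longrightarrow> (\<And>k::nat. g [^]\<^bsub>GL\<^esub> k \<in> H \<longleftrightarrow> N dvd k) \<Longrightarrow>
            component_group G \<cong> integer_mod_group N"
proof -
  let ?G = "GL\<lparr>carrier := G\<rparr>"
  interpret N: normal H ?G
    by (rule normal_H)
  interpret Q: group "component_group G"
    unfolding component_group_def by (rule N.factorgroup_is_group)
  obtain x where x: "x \<in> carrier (component_group G)"
      "carrier (component_group G) = range (\<lambda>k::int. x [^]\<^bsub>component_group G\<^esub> k)"
    using cyclic Q.cyclic_group by blast
  obtain g where g: "g \<in> G" "x = H #>\<^bsub>?G\<^esub> g"
    using x(1) unfolding component_group_def FactGroup_def RCOSETS_def by auto
  have pow: "x [^]\<^bsub>component_group G\<^esub> k = H #>\<^bsub>?G\<^esub> (g [^]\<^bsub>GL\<^esub> k)" for k :: nat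
  proof -
    have "group_hom ?G (component_group G) ((#>\<^bsub>?G\<^esub>) H)"
      using N.r_coset_hom_Mod N.is_group Q.is_group
      unfolding component_group_def group_hom_def group_hom_axioms_def by blast
    then have "x [^]\<^bsub>component_group G\<^esub> k = H #>\<^bsub>?G\<^esub> (g [^]\<^bsub>?G\<^esub> k)"
      using group_hom.hom_nat_pow[of ?G "component_group G" "(#>\<^bsub>?G\<^esub>) H" g k] g(1) unfolding g(2)
      by simp
    then show ?thesis
      by (simp add: nat_pow_def)
  qed
  have gk: "g [^]\<^bsub>GL\<^esub> k \<in> G" for k :: nat
    using N.nat_pow_closed[of g k] g by (simp add: nat_pow_def)
  show thesis
  proof (rule that[OF g(1)])
    fix A assume "A \<in> G"
    then have "H #>\<^bsub>?G\<^esub> A \<in> carrier (component_group G)"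
      unfolding component_group_def FactGroup_def RCOSETS_def by auto
    moreover have "carrier (component_group G) = range (\<lambda>k::nat. x [^]\<^bsub>component_group G\<^esub> k)"
    proof -
      \<comment> \<open>Finiteness of the quotient lets an integer exponent be reduced modulo the
        order of \<open>x\<close> to a natural one.\<close>
      have "x [^]\<^bsub>component_group G\<^esub> i = x [^]\<^bsub>component_group G\<^esub> nat (i mod int (Q.ord x))" for i :: int
        using Q.int_pow_eq[OF x(1), of i "i mod int (Q.ord x)"] Q.ord_ge_1[OF finite_index x(1)]
        by (simp add: mod_eq_dvd_iff[symmetric] int_pow_def2)
      then have "range (\<lambda>k::int. x [^]\<^bsub>component_group G\<^esub> k)
          \<subseteq> range (\<lambda>k::nat. x [^]\<^bsub>component_group G\<^esub> k)"
        by blast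
      moreover have "range (\<lambda>k::nat. x [^]\<^bsub>component_group G\<^esub> k) \<subseteq> carrier (component_group G)"
        using x(1) Q.nat_pow_closed by auto
      ultimately show ?thesis
        unfolding x(2)[symmetric] by (rule subset_antisym)
    qed
    ultimately obtain k :: nat where "H #>\<^bsub>?G\<^esub> A = H #>\<^bsub>?G\<^esub> (g [^]\<^bsub>GL\<^esub> k)"
      using pow by auto
    moreover have "A \<in> H #>\<^bsub>?G\<^esub> A"
      using N.rcos_self[of A] N.subgroup_axioms \<open>A \<in> G\<close> by simp
    ultimately show "\<exists>h\<in>H. \<exists>k::nat. A = h ** (g [^]\<^bsub>GL\<^esub> k)"
      by (auto simp: r_coset_def)
  next
    fix N :: nat
    assume "N > 0" and N: "\<And>k::nat. g [^]\<^bsub>GL\<^esub> k \<in> H \<longleftrightarrow> N dvd k"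
    show "component_group G \<cong> integer_mod_group N"
    proof (rule Q.cyclic_iso_integer_mod_group[OF x _ \<open>N > 0\<close>])
      fix k :: nat
      have "x [^]\<^bsub>component_group G\<^esub> k = \<one>\<^bsub>component_group G\<^esub> \<longleftrightarrow> H #>\<^bsub>?G\<^esub> (g [^]\<^bsub>GL\<^esub> k) = H"
        by (simp add: pow) (simp add: component_group_def FactGroup_def)
      also have "\<dots> \<longleftrightarrow> g [^]\<^bsub>GL\<^esub> k \<in> H"
        using N.rcos_self[of "g [^]\<^bsub>GL\<^esub> k" H] N.subgroup_axioms gk[of k]
          N.rcos_const[OF N.is_group, of "g [^]\<^bsub>GL\<^esub> k"] by auto
      finally show "x [^]\<^bsub>component_group G\<^esub> k = \<one>\<^bsub>component_group G\<^esub> \<longleftrightarrow> N dvd k"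
        using N by simp
    qed
  qed
qed

end

subsection \<open>Monomial form of imprimitive groups of prime degree\<close>

lemma matrix_vector_mult_axis: "A *v axis k (1::'a::comm_semiring_1) = column k A"
  by (simp add: vec_eq_iff matrix_vector_mult_def axis_def column_def if_distrib cong: if_cong)

lemma irreducible_groupD:
  assumes "irreducible_group G" "vec.subspace W" "\<And>A w. A \<in> G \<Longrightarrow> w \<in> W \<Longrightarrow> A *v w \<in> W"
    and "w \<in> W" "w \<noteq> 0"
  shows "W = UNIV"
proof -
  have "W = {0} \<or> W = UNIV"
    using assms(1-3) unfolding irreducible_group_def by simp
  then show ?thesis
    using assms(4,5) by blast
qed

locale direct_decomposition =
  fixes V :: "nat \<Rightarrow> ('a::field ^ 'n) set" and k :: nat
  assumes subspace_V: "i < k \<Longrightarrow> vec.subspace (V i)"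
    and V_nonzero: "i < k \<Longrightarrow> V i \<noteq> {0}"
    and decomp: "\<exists>!w. w \<in> (\<Pi>\<^sub>E i\<in>{..<k}. V i) \<and> v = (\<Sum>i<k. w i)"
begin

text \<open>The sum of the subspaces indexed by \<open>I\<close>. It serves both the dimension
  count, by induction on \<open>I\<close>, and the span of an orbit of summands.\<close>

definition part :: "nat set \<Rightarrow> ('a ^ 'n) set" where
  "part I = {\<Sum>i\<in>I. w i | w. \<forall>i\<in>I. w i \<in> V i}"

lemma decomp_zero:
  assumes "\<And>i. i < k \<Longrightarrow> w i \<in> V i" "(\<Sum>i<k. w i) = 0" "i < k"
  shows "w i = 0"
proof -
  have "restrict w {..<k} \<in> (\<Pi>\<^sub>E i\<in>{..<k}. V i)" "0 = (\<Sum>i<k. restrict w {..<k} i)"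
    "restrict (\<lambda>_. 0) {..<k} \<in> (\<Pi>\<^sub>E i\<in>{..<k}. V i)" "0 = (\<Sum>i<k. restrict (\<lambda>_. 0) {..<k} i)"
    using assms subspace_V by (auto simp: vec.subspace_0)
  then have "restrict w {..<k} = restrict (\<lambda>_. 0) {..<k}"
    using decomp[of 0] by blast
  then show ?thesis
    using \<open>i < k\<close> by (metis lessThan_iff restrict_apply')
qed

lemma part_empty: "part {} = {0}"
  by (auto simp: part_def)

lemma part_insert:
  assumes "finite I" "j \<notin> I"
  shows "part (insert j I) = {x + y |x y. x \<in> V j \<and> y \<in> part I}"
proof (intro Set.set_eqI iffI)
  fix v assume "v \<in> part (insert j I)"
  then show "v \<in> {x + y |x y. x \<in> V j \<and> y \<in> part I}"
    using assms unfolding part_def by auto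
next
  fix v assume "v \<in> {x + y |x y. x \<in> V j \<and> y \<in> part I}"
  then obtain x w where "x \<in> V j" "\<forall>i\<in>I. w i \<in> V i" "v = x + (\<Sum>i\<in>I. w i)"
    unfolding part_def by blast
  moreover have "(\<Sum>i\<in>I. w i) = (\<Sum>i\<in>I. (w(j := x)) i)"
    using assms by (auto intro!: sum.cong)
  ultimately have "v = (\<Sum>i\<in>insert j I. (w(j := x)) i)" "\<forall>i\<in>insert j I. (w(j := x)) i \<in> V i"
    using assms by auto
  then show "v \<in> part (insert j I)"
    unfolding part_def by blast
qed

lemma dim_part:
  assumes "I \<subseteq> {..<k}"
  shows "vec.subspace (part I) \<and> vec.dim (part I) = (\<Sum>i\<in>I. vec.dim (V i))"
proof -
  have "finite I"
    using assms finite_subset by blast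
  then show ?thesis
    using assms
  proof (induction I rule: finite_induct)
    case empty
    then show ?case
      by (simp add: part_empty)
  next
    case (insert j I)
    then have j: "j < k" and IH: "vec.subspace (part I)" "vec.dim (part I) = (\<Sum>i\<in>I. vec.dim (V i))"
      by auto
    have "V j \<inter> part I \<subseteq> {0}"
    proof
      fix v assume v: "v \<in> V j \<inter> part I"
      then obtain w where w: "\<forall>i\<in>I. w i \<in> V i" "v = (\<Sum>i\<in>I. w i)"
        unfolding part_def by blast
      \<comment> \<open>The components of \<open>v\<close> in \<open>part I\<close> together with
        \<open>- v\<close> in \<open>V j\<close> sum to zero, so uniqueness of the decomposition
        forces \<open>v = 0\<close>.\<close>
      define w' where "w' i = (if i \<in> I then w i else if i = j then - v else 0)" for i
      have "(\<Sum>i<k. w' i) = (\<Sum>i\<in>insert j I. w' i)"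
        by (rule sum.mono_neutral_right) (use insert.prems in \<open>auto simp: w'_def\<close>)
      also have "\<dots> = w' j + (\<Sum>i\<in>I. w' i)"
        using insert.hyps by simp
      also have "w' j = - v"
        using insert.hyps by (simp add: w'_def)
      also have "(\<Sum>i\<in>I. w' i) = v"
        unfolding w(2) by (rule sum.cong) (auto simp: w'_def)
      finally have "(\<Sum>i<k. w' i) = 0"
        by simp
      moreover have "w' i \<in> V i" if "i < k" for i
        using w v subspace_V[OF that] by (auto simp: w'_def vec.subspace_0 vec.subspace_neg)
      ultimately have "w' j = 0"
        using j decomp_zero by blast
      then show "v \<in> {0}"
        using \<open>w' j = - v\<close> by simp
    qed
    then have "V j \<inter> part I = {0}"
      using subspace_V[OF j] IH(1) by (auto simp: vec.subspace_0)
    then show ?case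
      using vec.dim_sums_Int[OF subspace_V[OF j] IH(1)] IH(2) insert.hyps
        vec.subspace_sums[OF subspace_V[OF j] IH(1)]
      by (simp add: part_insert)
  qed
qed

lemma part_all: "part {..<k} = UNIV"
  using decomp unfolding part_def by (force simp: PiE_iff)

lemma sum_dim: "(\<Sum>i<k. vec.dim (V i)) = CARD('n)"
  using dim_part[of "{..<k}"] by (simp add: part_all card_cart_basis)

lemma dim_pos: "i < k \<Longrightarrow> vec.dim (V i) > 0"
  using vec.dim_eq_0[of "V i"] V_nonzero[of i] vec.subspace_0[OF subspace_V] by fastforce

text \<open>Every summand has positive dimension, so leaving one out loses dimension.\<close>

lemma part_UNIV_D:
  assumes "I \<subseteq> {..<k}" "part I = UNIV"
  shows "I = {..<k}"
proof (rule ccontr)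
  assume "I \<noteq> {..<k}"
  then obtain j where "j \<in> {..<k} - I"
    using assms(1) by blast
  then have "(\<Sum>i\<in>I. vec.dim (V i)) < (\<Sum>i<k. vec.dim (V i))"
    using assms dim_pos by (intro sum_strict_mono2[of _ _ j]) auto
  then show False
    using dim_part[OF assms(1)] assms(2) sum_dim by (simp add: card_cart_basis)
qed

end

text \<open>For invertible \<open>P\<close>, the matrix of \<open>A\<close> in the basis formed by
  the columns of \<open>P\<close>.\<close>

definition conj_by :: "'a::field ^ 'n ^ 'n \<Rightarrow> 'a ^ 'n ^ 'n \<Rightarrow> 'a ^ 'n ^ 'n" where
  "conj_by P A = matrix_inv P ** A ** P"

text \<open>Transitivity on the summands comes from irreducibility: the sum over the orbit of
  \<open>V 0\<close> is invariant and nonzero. So all summands have equal dimension, and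
  \<open>k\<close> divides the prime \<open>n\<close> with \<open>k \<ge> 2\<close>. The columns of
  \<open>P\<close> span the resulting lines. The equivalence in the conclusion also records which
  entries are nonzero, not only which may be.\<close>

lemma imprimitive_monomial_form:
  fixes G :: "('a::field ^ 'n ^ 'n) set"
  assumes "prime CARD('n)" "irreducible_group G" "imprimitive_group G"
    and inv: "\<And>A. A \<in> G \<Longrightarrow> invertible A"
    and mult: "\<And>A B. A \<in> G \<Longrightarrow> B \<in> G \<Longrightarrow> A ** B \<in> G" and one: "mat 1 \<in> G"
  obtains P :: "'a ^ 'n ^ 'n" where "invertible P"
    "\<And>A. A \<in> G \<Longrightarrow> \<exists>\<pi>. \<forall>i j. conj_by P A $ i $ j \<noteq> 0 \<longleftrightarrow> i = \<pi> j"
proof -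
  obtain k and V :: "nat \<Rightarrow> ('a ^ 'n) set" where k: "k \<ge> 2" and VV: "\<forall>i<k. vec.subspace (V i) \<and> V i \<noteq> {0}"
      and dec: "\<forall>v. \<exists>!w. w \<in> (\<Pi>\<^sub>E i\<in>{..<k}. V i) \<and> v = (\<Sum>i<k. w i)"
      and perm: "\<forall>A\<in>G. \<exists>\<pi>. \<pi> permutes {..<k} \<and> (\<forall>i<k. (*v) A ` V i = V (\<pi> i))"
    using assms(3) unfolding imprimitive_group_def by blast
  interpret direct_decomposition V k
  proof
    fix i assume "i < k"
    then show "vec.subspace (V i)" "V i \<noteq> {0}"
      using VV by simp_all
  next
    show "\<exists>!w. w \<in> (\<Pi>\<^sub>E i\<in>{..<k}. V i) \<and> v = (\<Sum>i<k. w i)" for v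
      by (rule dec[rule_format])
  qed
  \<comment> \<open>The orbit of \<open>V 0\<close> under \<open>G\<close>.\<close>
  define I where "I = {i \<in> {..<k}. \<exists>A\<in>G. (*v) A ` V 0 = V i}"
  have I: "I \<subseteq> {..<k}"
    by (auto simp: I_def)
  have "0 \<in> I"
    using k one by (force simp: I_def)
  have "A *v v \<in> part I" if A: "A \<in> G" and v: "v \<in> part I" for A v
  proof -
    obtain w where w: "\<forall>i\<in>I. w i \<in> V i" "v = (\<Sum>i\<in>I. w i)"
      using v unfolding part_def by blast
    obtain \<pi> where \<pi>: "\<pi> permutes {..<k}" "\<forall>i<k. (*v) A ` V i = V (\<pi> i)"
      using perm A by blast
    have inj: "inj_on \<pi> I"
      using \<pi>(1) by (meson inj_on_subset permutes_inj subset_UNIV)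
    have "\<pi> ` I \<subseteq> I"
    proof safe
      fix i assume "i \<in> I"
      then obtain B where B: "i < k" "B \<in> G" "(*v) B ` V 0 = V i"
        unfolding I_def by blast
      have "(*v) (A ** B) ` V 0 = (*v) A ` ((*v) B ` V 0)"
        by (simp add: image_image matrix_vector_mul_assoc)
      also have "\<dots> = V (\<pi> i)"
        using B \<pi> by simp
      finally show "\<pi> i \<in> I"
        using mult[OF A B(2)] permutes_in_image[OF \<pi>(1)] B(1) unfolding I_def by blast
    qed
    then have \<pi>I: "\<pi> ` I = I"
      using inj I by (intro endo_inj_surj) (auto intro: finite_subset)
    \<comment> \<open>\<open>A\<close> moves the component in \<open>V i\<close> to
      \<open>V (\<pi> i)\<close>, so the components of \<open>A *v v\<close> are those of
      \<open>v\<close> relabelled along the inverse of \<pi>.\<close>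
    define w' where "w' j = A *v w (inv_into I \<pi> j)" for j
    have w': "w' (\<pi> i) = A *v w i" if "i \<in> I" for i
      using that inj by (simp add: w'_def)
    have "A *v v = (\<Sum>i\<in>I. A *v w i)"
      by (simp add: w(2) vec.linear_sum)
    also have "\<dots> = (\<Sum>i\<in>I. w' (\<pi> i))"
      by (rule sum.cong) (simp_all add: w')
    also have "\<dots> = (\<Sum>j\<in>I. w' j)"
      using sum.reindex[OF inj, of w'] by (simp add: \<pi>I)
    finally have "A *v v = (\<Sum>j\<in>I. w' j)" .
    moreover have "w' j \<in> V j" if j: "j \<in> I" for j
    proof -
      obtain i where i: "i \<in> I" "j = \<pi> i"
        using j \<pi>I by (metis imageE)
      have "A *v w i \<in> (*v) A ` V i"
        using w(1) i(1) by blast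
      moreover have "(*v) A ` V i = V (\<pi> i)"
        using \<pi>(2) i(1) I by blast
      ultimately show ?thesis
        unfolding i(2) w'[OF i(1)] by simp
    qed
    ultimately show ?thesis
      unfolding part_def by blast
  qed
  moreover have "part I \<noteq> {0}"
  proof -
    have "vec.dim (part I) > 0"
      using dim_part[OF I] dim_pos[of 0] k \<open>0 \<in> I\<close> member_le_sum[of 0 I "\<lambda>i. vec.dim (V i)"] I
      by (auto intro: finite_subset less_le_trans)
    then show ?thesis
      by (metis less_irrefl order_refl vec.dim_eq_0)
  qed
  ultimately have "part I = UNIV"
    using assms(2) dim_part[OF I] unfolding irreducible_group_def by blast
  then have I_eq: "I = {..<k}"
    using part_UNIV_D I by blast
  have dim_eq: "vec.dim (V i) = vec.dim (V 0)" if i: "i < k" for i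
  proof -
    obtain A where A: "A \<in> G" "(*v) A ` V 0 = V i"
      using i I_eq unfolding I_def by blast
    then have "inj ((*v) A)"
      using inv[OF A(1)] by (metis invertible_def matrix_left_invertible_injective)
    then have "inj_on ((*v) A) (vec.span (V 0))"
      using inj_on_subset by blast
    then show ?thesis
      using vec.dim_image_eq[of "(*v) A" "V 0"] A(2) by simp
  qed
  have "(\<Sum>i<k. vec.dim (V i)) = (\<Sum>i<k. vec.dim (V 0))"
    by (rule sum.cong[OF refl], rule dim_eq) simp
  then have card: "k * vec.dim (V 0) = CARD('n)"
    using sum_dim by simp
  then have "k dvd CARD('n)"
    by (metis dvd_triv_left)
  then have k_eq: "k = CARD('n)"
    using assms(1) k by (auto simp: prime_nat_iff)
  then have "vec.dim (V 0) = 1"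
    using card k by simp
  then have dim1: "vec.dim (V i) = 1" if "i < k" for i
    using dim_eq[OF that] by simp
  have "\<exists>x. x \<in> V i \<and> x \<noteq> 0 \<and> V i = range (\<lambda>c. c *s x)" if i: "i < k" for i
  proof -
    obtain x where x: "x \<in> V i" "x \<noteq> 0"
      using V_nonzero[OF i] vec.subspace_0[OF subspace_V[OF i]] by blast
    have "vec.independent {x}"
      using x(2) by simp
    then have "vec.dim {x} = 1"
      using vec.dim_eq_card_independent by fastforce
    then have "vec.span {x} = vec.span (V i)"
      using x(1) dim1[OF i] by (intro vec.dim_eq_span) auto
    also have "\<dots> = V i"
      using subspace_V[OF i] by (simp only: vec.span_eq_iff)
    finally show ?thesis
      using x by (auto simp: vec.span_singleton)
  qed
  then obtain x where x: "\<And>i. i < k \<Longrightarrow> x i \<in> V i \<and> x i \<noteq> 0 \<and> V i = range (\<lambda>c. c *s x i)"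
    by metis
  have "\<exists>\<beta>. bij_betw \<beta> (UNIV :: 'n set) {..<k}"
    by (rule finite_same_card_bij) (simp_all add: k_eq)
  then obtain \<beta> :: "'n \<Rightarrow> nat" where \<beta>: "bij_betw \<beta> UNIV {..<k}" ..
  have \<beta>_lt: "\<beta> j < k" for j
    using \<beta> by (auto simp: bij_betw_def)
  define P :: "'a ^ 'n ^ 'n" where "P = (\<chi> i j. x (\<beta> j) $ i)"
  have P_axis: "P *v axis j 1 = x (\<beta> j)" for j
    by (simp add: matrix_vector_mult_axis column_def P_def vec_lambda_eta)
  have "\<exists>c. P *v c = v" for v
  proof -
    have "v \<in> part {..<k}"
      by (simp add: part_all)
    then obtain w where w: "\<forall>i<k. w i \<in> V i" "v = (\<Sum>i<k. w i)"
      unfolding part_def by auto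
    have "\<exists>c. i < k \<longrightarrow> w i = c *s x i" for i
    proof (cases "i < k")
      case True
      then have "w i \<in> V i"
        using w(1) by blast
      also have "V i = range (\<lambda>c. c *s x i)"
        using x[OF True] by (elim conjE)
      finally have "w i \<in> range (\<lambda>c. c *s x i)" .
      then show ?thesis by blast
    qed simp
    then obtain c where c: "\<And>i. i < k \<Longrightarrow> w i = c i *s x i"
      by metis
    have "v = (\<Sum>i<k. c i *s x i)"
      using w(2) c by simp
    also have "\<dots> = (\<Sum>j\<in>UNIV. c (\<beta> j) *s x (\<beta> j))"
      using sum.reindex_bij_betw[OF \<beta>, of "\<lambda>i. c i *s x i"] by simp
    also have "\<dots> = P *v (\<chi> j. c (\<beta> j))"
      by (simp add: matrix_mult_sum column_def P_def vec_lambda_eta)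
    finally show ?thesis by metis
  qed
  then have P: "invertible P"
    using matrix_right_invertible_surjective[of P] invertible_right_inverse[of P]
    by (metis surj_def)
  have "\<exists>\<pi>. \<forall>i j. conj_by P A $ i $ j \<noteq> 0 \<longleftrightarrow> i = \<pi> j" if A: "A \<in> G" for A
  proof -
    obtain p where p: "p permutes {..<k}" "\<forall>i<k. (*v) A ` V i = V (p i)"
      using perm A by blast
    define \<pi> where "\<pi> j = inv_into UNIV \<beta> (p (\<beta> j))" for j
    have "conj_by P A $ i $ j \<noteq> 0 \<longleftrightarrow> i = \<pi> j" for i j
    proof -
      have pj: "p (\<beta> j) < k"
        using permutes_in_image[OF p(1)] \<beta>_lt by auto
      then have \<beta>\<pi>: "\<beta> (\<pi> j) = p (\<beta> j)"
        using \<beta> by (auto simp: \<pi>_def bij_betw_def f_inv_into_f)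
      have "A *v x (\<beta> j) \<in> V (p (\<beta> j))"
        using p(2) x \<beta>_lt by blast
      also have "V (p (\<beta> j)) = range (\<lambda>c. c *s x (\<beta> (\<pi> j)))"
        using x[OF pj] unfolding \<beta>\<pi> by (elim conjE)
      finally have "A *v x (\<beta> j) \<in> range (\<lambda>c. c *s x (\<beta> (\<pi> j)))" .
      then obtain c where c: "A *v x (\<beta> j) = c *s x (\<beta> (\<pi> j))"
        by blast
      have "A *v x (\<beta> j) \<noteq> 0"
        using inv[OF A] x[OF \<beta>_lt] by (metis invertible_def matrix_left_invertible_ker)
      then have "c \<noteq> 0"
        using c by auto
      have "conj_by P A *v axis j 1 = matrix_inv P *v (A *v (P *v axis j 1))"
        by (simp add: conj_by_def matrix_vector_mul_assoc matrix_mul_assoc)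
      also have "\<dots> = c *s (matrix_inv P *v (P *v axis (\<pi> j) 1))"
        by (simp add: P_axis c vec.scale)
      also have "\<dots> = c *s axis (\<pi> j) 1"
        using matrix_inv_invertible(2)[OF P] by (simp add: matrix_vector_mul_assoc)
      finally have "(conj_by P A *v axis j 1) $ i = (c *s axis (\<pi> j) 1) $ i"
        by simp
      then have "conj_by P A $ i $ j = c * (if i = \<pi> j then 1 else 0)"
        unfolding matrix_vector_mult_axis by (simp add: column_def axis_def)
      then show ?thesis
        using \<open>c \<noteq> 0\<close> by simp
    qed
    then show ?thesis by blast
  qed
  with P that show thesis by blast
qed

subsection \<open>Monomial groups with cyclic component group\<close>

definition diagonal :: "'a::zero ^ 'n ^ 'n \<Rightarrow> bool" where
  "diagonal A \<longleftrightarrow> (\<forall>i j. i \<noteq> j \<longrightarrow> A $ i $ j = 0)"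

lemma matrix_mult_monomial_entry:
  fixes A :: "'a::comm_semiring_1 ^ 'n ^ 'm" and B :: "'a ^ 'l ^ 'n"
  assumes "\<And>i. i \<noteq> p \<Longrightarrow> B $ i $ j = 0"
  shows "(A ** B) $ i $ j = A $ i $ p * B $ p $ j"
proof -
  have "(A ** B) $ i $ j = (\<Sum>l\<in>UNIV. A $ i $ l * B $ l $ j)"
    by (simp add: matrix_matrix_mult_def)
  also have "\<dots> = (\<Sum>l\<in>{p}. A $ i $ l * B $ l $ j)"
    by (rule sum.mono_neutral_right) (auto simp: assms)
  finally show ?thesis by simp
qed

lemma diagonal_mult_entry:
  fixes A B :: "'a::comm_semiring_1 ^ 'n ^ 'n"
  assumes "diagonal A"
  shows "(A ** B) $ i $ j = A $ i $ i * B $ i $ j"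
proof -
  have "(A ** B) $ i $ j = (\<Sum>l\<in>UNIV. A $ i $ l * B $ l $ j)"
    by (simp add: matrix_matrix_mult_def)
  also have "\<dots> = (\<Sum>l\<in>{i}. A $ i $ l * B $ l $ j)"
    by (rule sum.mono_neutral_right) (use assms in \<open>auto simp: diagonal_def\<close>)
  finally show ?thesis by simp
qed

lemma mult_diagonal_entry:
  fixes A B :: "'a::comm_semiring_1 ^ 'n ^ 'n"
  assumes "diagonal B"
  shows "(A ** B) $ i $ j = A $ i $ j * B $ j $ j"
  using assms by (intro matrix_mult_monomial_entry) (auto simp: diagonal_def)

lemma conj_by_mult:
  assumes "invertible P"
  shows "conj_by P (A ** B) = conj_by P A ** conj_by P B"
proof -
  have "conj_by P A ** conj_by P B = matrix_inv P ** A ** (P ** matrix_inv P) ** B ** P"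
    by (simp only: conj_by_def matrix_mul_assoc)
  then show ?thesis
    using matrix_inv_invertible[OF assms] by (simp add: conj_by_def matrix_mul_assoc)
qed

lemma conj_by_one: "invertible P \<Longrightarrow> conj_by P (mat 1) = mat 1"
  by (simp add: conj_by_def matrix_inv_invertible)

lemma conj_by_cancel:
  assumes "invertible P"
  shows "P ** conj_by P A ** matrix_inv P = A" "conj_by P (P ** A ** matrix_inv P) = A"
proof -
  have "P ** conj_by P A ** matrix_inv P = (P ** matrix_inv P) ** A ** (P ** matrix_inv P)"
    "conj_by P (P ** A ** matrix_inv P) = (matrix_inv P ** P) ** A ** (matrix_inv P ** P)"
    by (simp_all only: conj_by_def matrix_mul_assoc)
  then show "P ** conj_by P A ** matrix_inv P = A" "conj_by P (P ** A ** matrix_inv P) = A"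
    using matrix_inv_invertible[OF assms] by simp_all
qed

lemma det_conj_by:
  assumes "invertible P"
  shows "det (conj_by P A) = det A"
proof -
  have "det (matrix_inv P) * det P = 1"
    using matrix_inv_invertible(2)[OF assms] det_mul[of "matrix_inv P" P] by (simp add: det_I)
  then show ?thesis
    by (simp add: conj_by_def det_mul)
qed

lemma GL_regular_conj_by: "(\<lambda>A. conj_by P A $ i $ j) \<in> GL_regular"
  unfolding conj_by_def by (rule GL_regular_entry_mult2)

lemma pow_GL_0: "A [^]\<^bsub>GL\<^esub> (0::nat) = mat 1"
  and pow_GL_Suc: "A [^]\<^bsub>GL\<^esub> Suc k = A [^]\<^bsub>GL\<^esub> k ** A"
  by (simp_all add: nat_pow_def)

lemma pow_GL_Suc2: "A [^]\<^bsub>GL\<^esub> Suc k = A ** A [^]\<^bsub>GL\<^esub> k"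
proof (induction k)
  case (Suc k)
  then show ?case
    by (metis pow_GL_Suc matrix_mul_assoc)
qed (simp add: pow_GL_0 pow_GL_Suc)

lemma invertible_pow_GL:
  fixes A :: "'a::field ^ 'n ^ 'n"
  assumes "invertible A"
  shows "invertible (A [^]\<^bsub>GL\<^esub> (k::nat))"
proof -
  interpret GL: group "GL :: ('a ^ 'n ^ 'n) monoid"
    by (rule group_GL)
  show ?thesis
    using GL.nat_pow_closed[of A k] assms by simp
qed

lemma mat_entry: "mat c $ i $ j = (if i = j then c else 0)"
  by (simp add: mat_def)

locale monomial_cyclic_group = linear_algebraic_group G
  for G :: "('a::alg_closed_field ^ 'n ^ 'n) set" +
  fixes P g :: "'a ^ 'n ^ 'n" and n :: nat
  assumes n: "n = CARD('n)" and prime_n: "prime n"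
    and irreducible: "irreducible_group G"
    and P: "invertible P"
    and monomial: "A \<in> G \<Longrightarrow> \<exists>\<pi>. \<forall>i j. conj_by P A $ i $ j \<noteq> 0 \<longleftrightarrow> i = \<pi> j"
    and g: "g \<in> G"
    and generates: "A \<in> G \<Longrightarrow> \<exists>h\<in>H. \<exists>k::nat. A = h ** (g [^]\<^bsub>GL\<^esub> k)"
begin

abbreviation M where "M \<equiv> conj_by P"

lemma M_mult: "M (A ** B) = M A ** M B"
  using P by (rule conj_by_mult)

lemma n_gt_1: "n > 1"
  using prime_n by (rule prime_gt_1_nat)

lemma diagonal_H:
  assumes "A \<in> H"
  shows "diagonal (M A)"
  unfolding diagonal_def
proof (intro allI impI)
  fix i j :: 'n assume "i \<noteq> j"
  \<comment> \<open>By monomiality the vanishing of the entry at \<open>(i, j)\<close> is an open and closed condition on \<open>H\<close>.\<close>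
  let ?E1 = "{X \<in> carrier GL. M X $ i $ j = 0}"
  let ?S = "(\<lambda>l X. M X $ l $ j) ` (- {i})"
  let ?E2 = "{X \<in> carrier GL. \<forall>f\<in>?S. f X = 0}"
  have "closedin zariski ?E1"
    unfolding closedin_zariski by (intro zariski_closed_zero_set GL_regular_conj_by)
  moreover have "?S \<subseteq> GL_regular"
    using GL_regular_conj_by by blast
  then have "closedin zariski ?E2"
    unfolding closedin_zariski zariski_closed_def by blast
  moreover have column: "M X $ i $ j = 0 \<longleftrightarrow> \<not> (\<forall>l. l \<noteq> i \<longrightarrow> M X $ l $ j = 0)" if "X \<in> H" for X
    using monomial[of X] that H_subset by (metis subsetD)
  have "H \<subseteq> carrier GL"
    using H_subset invertible_G by auto
  then have "H \<subseteq> ?E1 \<union> ?E2" "?E1 \<inter> ?E2 \<inter> H = {}"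
    using column by auto
  moreover have "mat 1 \<in> ?E1 \<inter> H"
    using one_in_H \<open>i \<noteq> j\<close> \<open>H \<subseteq> carrier GL\<close> by (auto simp: conj_by_one[OF P] mat_entry)
  ultimately have "?E2 \<inter> H = {}"
    using connected_H unfolding connectedin_closedin by blast
  then show "M A $ i $ j = 0"
    using assms column[OF assms] \<open>H \<subseteq> carrier GL\<close> by auto
qed

definition \<pi> where "\<pi> = (SOME p. \<forall>i j. M g $ i $ j \<noteq> 0 \<longleftrightarrow> i = p j)"

lemma M_g: "M g $ i $ j \<noteq> 0 \<longleftrightarrow> i = \<pi> j"
  using someI_ex[OF monomial[OF g]] unfolding \<pi>_def by blast

lemma mult_g_entry: "(A ** M g) $ i $ j = A $ i $ \<pi> j * M g $ \<pi> j $ j"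
  by (rule matrix_mult_monomial_entry) (use M_g in blast)

text \<open>The column map of the inverse of \<open>g\<close> is a left inverse of \<pi>.\<close>

lemma inj_\<pi>: "inj \<pi>"
proof -
  obtain \<sigma> where \<sigma>: "\<And>i j. M (matrix_inv g) $ i $ j \<noteq> 0 \<longleftrightarrow> i = \<sigma> j"
    using monomial[OF inv_in_G[OF g]] by blast
  have "\<sigma> (\<pi> j) = j" for j
  proof -
    have "M (matrix_inv g) ** M g = mat 1"
      using matrix_inv_invertible[OF invertible_G[OF g]] by (simp add: conj_by_one P flip: M_mult)
    then have "M (matrix_inv g) $ j $ \<pi> j * M g $ \<pi> j $ j = 1"
      using mult_g_entry[of "M (matrix_inv g)" j j] by (simp add: mat_entry)
    then show ?thesis
      using \<sigma> by (metis mult_zero_left zero_neq_one)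
  qed
  then show ?thesis
    by (rule inj_on_inverseI)
qed

lemma M_g_pow: "M (g [^]\<^bsub>GL\<^esub> k) $ i $ j \<noteq> 0 \<longleftrightarrow> i = (\<pi> ^^ k) j"
proof (induction k arbitrary: j)
  case 0
  then show ?case
    by (simp add: pow_GL_0 conj_by_one[OF P] mat_entry)
next
  case (Suc k)
  then show ?case
    using M_g by (simp add: pow_GL_Suc M_mult mult_g_entry funpow_swap1)
qed

text \<open>A diagonal factor on the left only rescales rows, so the support of any element of
  \<open>G\<close> is governed by a power of \<pi>.\<close>

lemma M_H_g_pow:
  assumes "h \<in> H"
  shows "M (h ** g [^]\<^bsub>GL\<^esub> k) $ i $ j \<noteq> 0 \<Longrightarrow> i = (\<pi> ^^ k) j"
  using M_g_pow by (auto simp: M_mult diagonal_mult_entry diagonal_H[OF assms])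

text \<open>
  \<open>\<pi>\<close> turns out to be an \<open>n\<close>-cycle; \<open>e\<close> enumerates the indices along it, so that conjugation by
  \<open>g\<close> shifts the sequence \<open>u A\<close> of diagonal entries.
\<close>

definition e :: "nat \<Rightarrow> 'n" where "e i = (\<pi> ^^ i) undefined"

lemma \<pi>_e: "\<pi> (e i) = e (Suc i)" and funpow_\<pi>_e: "(\<pi> ^^ k) (e i) = e (k + i)"
  by (simp_all add: e_def funpow_add)

text \<open>The basis vectors indexed by the \<pi>-orbit of the starting index span a
  \<open>G\<close>-invariant subspace, since elements of \<open>G\<close> move indices by powers of
  \<pi>. By irreducibility this orbit contains every index.\<close>

lemma surj_e: "range e = UNIV"
proof -
  \<comment> \<open>Vectors whose coordinates in the basis \<open>P\<close> vanish off the
    orbit.\<close>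
  let ?W = "{v. \<forall>i. i \<notin> range e \<longrightarrow> (matrix_inv P *v v) $ i = 0}"
  have sub: "vec.subspace ?W"
    by (rule vec.subspaceI) (auto simp: vec.add vec.scale)
  have inv: "A *v w \<in> ?W" if A: "A \<in> G" and w: "w \<in> ?W" for A w
  proof -
    obtain h k where h: "h \<in> H" "A = h ** g [^]\<^bsub>GL\<^esub> (k::nat)"
      using generates[OF A] by blast
    have "matrix_inv P *v (A *v w) = M A *v (matrix_inv P *v w)"
    proof -
      have "M A ** matrix_inv P = matrix_inv P ** A ** (P ** matrix_inv P)"
        by (simp only: conj_by_def matrix_mul_assoc)
      then have "M A ** matrix_inv P = matrix_inv P ** A"
        by (simp add: matrix_inv_invertible P)
      then show ?thesis
        by (simp add: matrix_vector_mul_assoc)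
    qed
    moreover have "(M A *v (matrix_inv P *v w)) $ i = 0" if i: "i \<notin> range e" for i
    proof -
      have "M A $ i $ l * (matrix_inv P *v w) $ l = 0" for l
      proof (cases "l \<in> range e")
        case True
        then obtain l' where "l = e l'"
          by blast
        then have "i \<noteq> (\<pi> ^^ k) l"
          using i by (auto simp: funpow_\<pi>_e)
        then show ?thesis
          using M_H_g_pow[OF h(1), of k i l] unfolding h(2) by auto
      next
        case False
        then show ?thesis
          using w by simp
      qed
      moreover have "(M A *v y) $ i = (\<Sum>l\<in>UNIV. M A $ i $ l * y $ l)" for y
        by (simp add: matrix_vector_mult_def)
      ultimately show ?thesis
        by (simp only: sum.neutral_const)
    qed
    ultimately show ?thesis by simp
  qed
  have Pax: "matrix_inv P *v (P *v axis l 1) = axis l 1" for l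
    by (simp add: matrix_vector_mul_assoc matrix_inv_invertible P)
  then have mem: "P *v axis (e 0) 1 \<in> ?W"
    by (auto simp: axis_def)
  have nz: "P *v axis (e 0) 1 \<noteq> 0"
    using Pax[of "e 0"] by (auto simp: axis_eq_0_iff)
  have "?W = UNIV"
    by (rule irreducible_groupD[OF irreducible sub inv mem nz])
  have "l \<in> range e" for l
  proof (rule ccontr)
    assume l: "l \<notin> range e"
    have "P *v axis l 1 \<in> ?W"
      unfolding \<open>?W = UNIV\<close> by simp
    then have "axis l (1::'a) $ l = 0"
      using l unfolding mem_Collect_eq Pax by blast
    then show False
      by (simp add: axis_def)
  qed
  then show ?thesis by blast
qed

text \<open>Let \<open>d\<close> be the least positive number with \<open>e d = e 0\<close>.
  Injectivity of \<pi> cancels common iterates, so \<open>e\<close> is injective on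
  \<open>{..<d}\<close>; its image there is already everything, whence \<open>d = n\<close>.\<close>

lemma e_eq_iff: "e i = e j \<longleftrightarrow> i mod n = j mod n"
proof -
  have "\<not> inj e"
    using infinite_UNIV_nat finite_imageD[of e UNIV] by auto
  then obtain a b where "a \<noteq> b" "e a = e b"
    by (auto simp: inj_def)
  then obtain a b where "a < b" "e a = e b"
    by (metis linorder_neqE_nat)
  then have "(\<pi> ^^ a) (e (b - a)) = (\<pi> ^^ a) (e 0)"
    by (simp add: funpow_\<pi>_e)
  then have "e (b - a) = e 0"
    by (rule injD[OF inj_fn[OF inj_\<pi>]])
  then have ex: "\<exists>d. d > 0 \<and> e d = e 0"
    using \<open>a < b\<close> by (intro exI[of _ "b - a"]) simp
  define d where "d = (LEAST d. d > 0 \<and> e d = e 0)"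
  have d: "d > 0" "e d = e 0"
    using LeastI_ex[OF ex] by (simp_all add: d_def)
  have d_min: "d \<le> c" if "c > 0" "e c = e 0" for c
    unfolding d_def using that by (intro Least_le) simp
  have shift: "e (i + d) = e i" for i
    using funpow_\<pi>_e[of i d] funpow_\<pi>_e[of i 0] d(2) by simp
  have "e (r + q * d) = e r" for r q
  proof (induction q)
    case (Suc q)
    have "e (r + Suc q * d) = e ((r + q * d) + d)"
      by (simp add: ac_simps)
    then show ?case
      using shift Suc by simp
  qed simp
  then have mod: "e i = e (i mod d)" for i
    by (metis mod_mult_div_eq mult.commute)
  have inj: "inj_on e {..<d}"
  proof (rule linorder_inj_onI')
    fix i j assume "i \<in> {..<d}" "j \<in> {..<d}" "i < j"
    show "e i \<noteq> e j"
    proof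
      assume "e i = e j"
      then have "(\<pi> ^^ i) (e (j - i)) = (\<pi> ^^ i) (e 0)"
        using \<open>i < j\<close> by (simp add: funpow_\<pi>_e)
      then have "e (j - i) = e 0"
        by (rule injD[OF inj_fn[OF inj_\<pi>]])
      then show False
        using d_min[of "j - i"] \<open>i < j\<close> \<open>j \<in> {..<d}\<close> by simp
    qed
  qed
  have "e ` {..<d} = UNIV"
  proof -
    have "e i \<in> e ` {..<d}" for i
      unfolding mod[of i] using d(1) by simp
    then show ?thesis
      unfolding surj_e[symmetric] by blast
  qed
  then have "d = n"
    using card_image[OF inj] n by simp
  have "e i = e j \<longleftrightarrow> e (i mod d) = e (j mod d)"
    unfolding mod[of i, symmetric] mod[of j, symmetric] ..
  also have "\<dots> \<longleftrightarrow> i mod d = j mod d"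
    using d(1) by (intro inj_on_eq_iff[OF inj]) simp_all
  finally have "e i = e j \<longleftrightarrow> i mod d = j mod d" .
  then show ?thesis
    by (simp add: \<open>d = n\<close>)
qed

lemma bij_e: "bij_betw e {..<n} UNIV"
proof -
  have "inj_on e {..<n}"
    by (auto simp: inj_on_def e_eq_iff)
  moreover have "e ` {..<n} = UNIV"
    using card_image[OF calculation] n by (intro card_subset_eq) auto
  ultimately show ?thesis
    by (simp add: bij_betw_def)
qed

lemma funpow_\<pi>_eq_iff: "(\<pi> ^^ k) j = j \<longleftrightarrow> n dvd k"
proof -
  obtain i where "j = e i"
    using surj_e by blast
  then show ?thesis
    using funpow_\<pi>_e[of k i] e_eq_iff[of "k + i" i] by (simp add: mod_eq_dvd_iff_nat)
qed

lemma diagonal_g_pow_iff: "diagonal (M (g [^]\<^bsub>GL\<^esub> k)) \<longleftrightarrow> n dvd k"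
proof
  assume "diagonal (M (g [^]\<^bsub>GL\<^esub> k))"
  then have "(\<pi> ^^ k) (e 0) = e 0"
    using M_g_pow[of k "(\<pi> ^^ k) (e 0)" "e 0"] by (auto simp: diagonal_def)
  then show "n dvd k"
    by (simp add: funpow_\<pi>_eq_iff)
next
  assume "n dvd k"
  then show "diagonal (M (g [^]\<^bsub>GL\<^esub> k))"
    using M_g_pow[of k] funpow_\<pi>_eq_iff unfolding diagonal_def by metis
qed

section \<open>Diagonal entries along the cycle and the full diagonal torus\<close>

definition u :: "'a ^ 'n ^ 'n \<Rightarrow> nat \<Rightarrow> 'a" where "u A i = M A $ e i $ e i"

text \<open>The whole torus that is diagonal in the basis \<open>P\<close>; membership in
  \<open>G\<close> is not demanded.\<close>

definition T :: "('a ^ 'n ^ 'n) set" where "T = {A. invertible A \<and> diagonal (M A)}"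

lemma H_subset_T: "H \<subseteq> T"
  using diagonal_H H_subset invertible_G by (auto simp: T_def)

lemma u_periodic: "u A (i + n) = u A i"
  using e_eq_iff[of "i + n" i] by (simp add: u_def)

lemma u_mod: "u A (i mod n) = u A i"
  using e_eq_iff[of "i mod n" i] by (simp add: u_def)

lemma u_mult: "A \<in> T \<Longrightarrow> u (A ** B) i = u A i * u B i"
  by (simp add: T_def u_def M_mult diagonal_mult_entry)

lemma det_eq_prod_u:
  assumes "A \<in> T"
  shows "det A = (\<Prod>i<n. u A i)"
proof -
  have "det (M A) = (\<Prod>j\<in>UNIV. M A $ j $ j)"
    using assms by (intro det_diagonal) (auto simp: T_def diagonal_def)
  also have "\<dots> = (\<Prod>i<n. u A i)"
    using prod.reindex_bij_betw[OF bij_e, of "\<lambda>j. M A $ j $ j"] by (simp add: u_def)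
  finally show ?thesis
    by (simp add: det_conj_by P)
qed

lemma u_nonzero:
  assumes "A \<in> T"
  shows "u A i \<noteq> 0"
proof -
  have "det A \<noteq> 0"
    using assms by (simp add: T_def invertible_det_nz)
  then have "u A (i mod n) \<noteq> 0"
    using n_gt_1 by (simp add: det_eq_prod_u assms)
  then show ?thesis
    by (simp add: u_mod)
qed

lemma T_eqI:
  assumes "A \<in> T" "B \<in> T" "\<And>i. i < n \<Longrightarrow> u A i = u B i"
  shows "A = B"
proof -
  have "M A $ i $ j = M B $ i $ j" for i j
  proof (cases "i = j")
    case True
    obtain l where "l < n" "j = e l"
      using bij_e by (auto simp: bij_betw_def)
    then show ?thesis
      using assms(3) True by (simp add: u_def)
  next
    case False
    then show ?thesis
      using assms by (simp add: T_def diagonal_def)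
  qed
  then have "M A = M B"
    by (simp add: vec_eq_iff)
  then show ?thesis
    using conj_by_cancel(1)[OF P] by metis
qed

text \<open>Compare both products at the nonzero entry of \<open>g\<close> in column
  \<open>e i\<close>. The hypothesis is an intertwining relation, so that it fits conjugates of
  elements of \<open>H\<close> as well as \<open>g^n\<close>, which commutes with
  \<open>g\<close>.\<close>

lemma u_conj:
  assumes "A \<in> T" "B \<in> T" "A ** g = g ** B"
  shows "u B i = u A (Suc i)"
proof -
  have "(M A ** M g) $ \<pi> (e i) $ e i = (M g ** M B) $ \<pi> (e i) $ e i"
    using assms(3) by (simp flip: M_mult)
  then have "M A $ \<pi> (e i) $ \<pi> (e i) * M g $ \<pi> (e i) $ e i = M g $ \<pi> (e i) $ e i * M B $ e i $ e i"
    using assms(1,2) by (simp add: T_def diagonal_mult_entry mult_diagonal_entry)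
  moreover have "M g $ \<pi> (e i) $ e i \<noteq> 0"
    by (simp add: M_g)
  ultimately show ?thesis
    by (simp add: u_def \<pi>_e)
qed

lemma H_shift:
  assumes "A \<in> H"
  obtains B where "B \<in> H" "\<And>i. u B i = u A (Suc i)"
proof (rule that)
  let ?B = "matrix_inv g ** A ** g"
  show "?B \<in> H"
    using conj_in_H[OF inv_in_G[OF g] assms] by (simp add: matrix_inv_inv invertible_G g)
  moreover have "g ** ?B = A ** g"
    using matrix_inv_invertible(1)[OF invertible_G[OF g]] by (simp add: matrix_mul_assoc)
  ultimately show "u ?B i = u A (Suc i)" for i
    using assms H_subset_T by (intro u_conj) auto
qed

lemma scalar_action:
  assumes "A \<in> T" "\<And>i. u A (Suc i) = u A i"
  shows "A *v x = u A 0 *s x"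
proof -
  have u0: "u A i = u A 0" for i
    by (induction i) (simp_all add: assms(2))
  have "M A $ i $ j = (mat (u A 0)) $ i $ j" for i j
  proof -
    obtain l where "j = e l"
      using surj_e by blast
    then show ?thesis
      using assms(1) u0[of l] by (auto simp: T_def diagonal_def mat_entry u_def)
  qed
  then have "M A = mat (u A 0)"
    by (simp add: vec_eq_iff)
  moreover have "mat c *v y = c *s y" for c :: 'a and y :: "'a ^ 'n"
    by (simp add: vec_eq_iff matrix_vector_mult_def mat_def if_distrib[of "\<lambda>x. x * _"] cong: if_cong)
  ultimately have "P ** M A ** matrix_inv P *v x = u A 0 *s ((P ** matrix_inv P) *v x)"
    by (simp add: vec.scale flip: matrix_vector_mul_assoc)
  then show ?thesis
    by (simp add: conj_by_cancel P matrix_inv_invertible)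
qed

lemma g_eigenvector:
  obtains w \<mu> where "w \<noteq> 0" "g *v w = \<mu> *s w"
proof -
  let ?gp = "\<lambda>k::nat. g [^]\<^bsub>GL\<^esub> k"
  have gpT: "?gp n \<in> T"
    by (simp add: T_def diagonal_g_pow_iff invertible_pow_GL invertible_G g)
  \<comment> \<open>Commuting with \<open>g\<close> makes the diagonal sequence of
    \<open>g^n\<close> invariant under the shift, so \<open>g^n\<close> is scalar.\<close>
  have "?gp n ** g = g ** ?gp n"
    by (metis pow_GL_Suc pow_GL_Suc2)
  then have "u (?gp n) (Suc i) = u (?gp n) i" for i
    using u_conj[OF gpT gpT] by simp
  then have gn: "?gp n *v x = u (?gp n) 0 *s x" for x
    using scalar_action[OF gpT] by blast
  obtain \<mu> where \<mu>: "\<mu> ^ n = u (?gp n) 0"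
    using nth_root_exists[of n "u (?gp n) 0"] n_gt_1 by auto
  have "\<mu> \<noteq> 0"
    using \<mu> u_nonzero[OF gpT, of 0] n_gt_1 by (metis power_0_left not_one_less_zero)
  define x where "x = P *v axis (e 0) 1"
  \<comment> \<open>\<open>g\<close> to the power \<open>n\<close> acts as \<open>\<mu> ^ n\<close>, so averaging the \<open>g\<close>-orbit of \<open>x\<close> yields an eigenvector.\<close>
  define y where "y i = inverse \<mu> ^ i *s (?gp i *v x)" for i
  define w where "w = (\<Sum>i<n. y i)"
  have gy: "g *v y i = \<mu> *s y (Suc i)" for i
    using \<open>\<mu> \<noteq> 0\<close>
    by (simp add: y_def vec.scale matrix_vector_mul_assoc flip: pow_GL_Suc2)
  have "y n = y 0"
    using \<open>\<mu> \<noteq> 0\<close> by (simp add: y_def gn pow_GL_0 power_inverse flip: \<mu>)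
  have "g *v w = \<mu> *s (\<Sum>i<n. y (Suc i))"
    by (simp add: w_def vec.linear_sum gy vec.scale_sum_right)
  also have "(\<Sum>i<n. y (Suc i)) = w"
    using sum.lessThan_Suc_shift[of y n] \<open>y n = y 0\<close> by (simp add: w_def)
  finally have gw: "g *v w = \<mu> *s w" .
  \<comment> \<open>For \<open>0 < i < n\<close> the power \<pi>^i moves \<open>e 0\<close>, so only
    the term \<open>i = 0\<close> contributes to this coordinate; hence \<open>w\<close> is
    nonzero.\<close>
  have "(matrix_inv P *v y i) $ e 0 = (if i = 0 then 1 else 0)" if "i < n" for i
  proof -
    have "matrix_inv P *v y i = inverse \<mu> ^ i *s (M (?gp i) *v axis (e 0) 1)"
      by (simp add: y_def x_def vec.scale conj_by_def matrix_vector_mul_assoc matrix_mul_assoc)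
    then have eq: "(matrix_inv P *v y i) $ e 0 = inverse \<mu> ^ i * M (?gp i) $ e 0 $ e 0"
      by (simp only: matrix_vector_mult_axis) (simp add: column_def)
    show ?thesis
    proof (cases "i = 0")
      case True
      then show ?thesis
        unfolding eq by (simp add: pow_GL_0 conj_by_one P mat_entry)
    next
      case False
      then have "\<not> n dvd i"
        using that by (auto dest: dvd_imp_le)
      then have "M (?gp i) $ e 0 $ e 0 = 0"
        using M_g_pow[of i "e 0" "e 0"] funpow_\<pi>_eq_iff[of i "e 0"] by metis
      then show ?thesis
        using False by (simp add: eq)
    qed
  qed
  then have "(matrix_inv P *v w) $ e 0 = (\<Sum>i<n. if i = 0 then 1 else 0)"
    by (simp add: w_def vec.linear_sum)
  also have "\<dots> = 1"
    using n_gt_1 by simp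
  finally have "w \<noteq> 0"
    by auto
  with gw that show thesis
    by blast
qed

lemma not_scalar: "\<exists>A\<in>H. u A (Suc 0) \<noteq> u A 0"
proof (rule ccontr)
  assume "\<not> ?thesis"
  \<comment> \<open>Equality of the first two entries for all of \<open>H\<close> propagates along
    the shift.\<close>
  then have "\<forall>A\<in>H. u A (Suc i) = u A i" for i
  proof (induction i)
    case (Suc i)
    show ?case
    proof
      fix A assume "A \<in> H"
      then obtain B where "B \<in> H" "\<And>i. u B i = u A (Suc i)"
        using H_shift by blast
      then show "u A (Suc (Suc i)) = u A (Suc i)"
        using Suc by metis
    qed
  qed blast
  then have H: "h *v x = u h 0 *s x" if "h \<in> H" for h x
    using scalar_action H_subset_T that by blast
  obtain w \<mu> where w: "w \<noteq> 0" "g *v w = \<mu> *s w"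
    by (rule g_eigenvector)
  have gp: "(g [^]\<^bsub>GL\<^esub> k) *v w = \<mu> ^ k *s w" for k :: nat
    by (induction k)
      (simp_all add: pow_GL_0 pow_GL_Suc2 w(2) vec.scale mult.commute flip: matrix_vector_mul_assoc)
  have inv: "A *v x \<in> vec.span {w}" if A: "A \<in> G" and x: "x \<in> vec.span {w}" for A x
  proof -
    obtain h k where h: "h \<in> H" "A = h ** g [^]\<^bsub>GL\<^esub> (k::nat)"
      using generates[OF A] by blast
    obtain c where "x = c *s w"
      using x by (auto simp: vec.span_singleton)
    then have "A *v x = (c * u h 0 * \<mu> ^ k) *s w"
      by (simp add: h(2) vec.scale gp H[OF h(1)] flip: matrix_vector_mul_assoc)
    then show ?thesis
      by (auto simp: vec.span_singleton)
  qed
  have "w \<in> vec.span {w}"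
    by (rule vec.span_base) simp
  from irreducible_groupD[OF irreducible vec.subspace_span inv this w(1)]
  have "vec.span {w} = UNIV" .
  then have "vec.dim {w} = n"
    by (metis vec.dim_span vec_dim_card n)
  moreover have "vec.dim {w} \<le> 1"
    using vec.dim_le_card'[of "{w}"] by simp
  ultimately show False
    using n_gt_1 by simp
qed

end

subsection \<open>Independence of characters\<close>

text \<open>Dedekind's argument: the relation at \<open>m x y\<close> minus \<open>\<psi> y\<close>
  times the relation at \<open>x\<close> no longer involves \<psi>. Induction kills the coefficients
  of the other characters, and evaluation at \<open>e\<close> kills that of \<psi>.\<close>

lemma characters_independent:
  fixes X :: "('b \<Rightarrow> 'a::field) set"
  assumes "finite X"
    and mult: "\<And>f x y. f \<in> X \<Longrightarrow> x \<in> H \<Longrightarrow> y \<in> H \<Longrightarrow> f (m x y) = f x * f y"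
    and one: "\<And>f. f \<in> X \<Longrightarrow> f e = 1" and e: "e \<in> H"
    and closed: "\<And>x y. x \<in> H \<Longrightarrow> y \<in> H \<Longrightarrow> m x y \<in> H"
    and distinct: "\<And>f \<psi>. f \<in> X \<Longrightarrow> \<psi> \<in> X \<Longrightarrow> f \<noteq> \<psi> \<Longrightarrow> \<exists>x\<in>H. f x \<noteq> \<psi> x"
    and zero: "\<And>x. x \<in> H \<Longrightarrow> (\<Sum>f\<in>X. c f * f x) = 0"
    and "f \<in> X"
  shows "c f = 0"
  using assms(1,2,3,6,7,8)
proof (induction X arbitrary: c f rule: finite_induct)
  case (insert \<psi> X)
  have X: "c f = 0" if f: "f \<in> X" for f
  proof -
    have "f \<noteq> \<psi>"
      using f insert.hyps by blast
    then obtain y where y: "y \<in> H" "f y \<noteq> \<psi> y"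
      using insert.prems(3)[of f \<psi>] f by blast
    have "c f * (f y - \<psi> y) = 0"
    proof (rule insert.IH[where c = "\<lambda>f. c f * (f y - \<psi> y)"])
      fix x assume x: "x \<in> H"
      have "(\<Sum>f\<in>X. c f * (f y - \<psi> y) * f x) =
          (\<Sum>f\<in>X. c f * f (m x y)) - \<psi> y * (\<Sum>f\<in>X. c f * f x)"
        unfolding sum_distrib_left sum_subtractf[symmetric]
        by (rule sum.cong) (use insert.prems(1) x y in \<open>auto simp: algebra_simps\<close>)
      also have "\<dots> = (\<Sum>f\<in>insert \<psi> X. c f * f (m x y)) - \<psi> y * (\<Sum>f\<in>insert \<psi> X. c f * f x)"
        using insert.hyps insert.prems(1)[of \<psi> x y] x y by (simp add: algebra_simps)
      also have "\<dots> = 0"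
        using insert.prems(4) x y closed by simp
      finally show "(\<Sum>f\<in>X. c f * (f y - \<psi> y) * f x) = 0" .
    qed (use insert.prems f in auto)
    with y show ?thesis by simp
  qed
  have "c \<psi> = 0"
    using insert.prems(4)[OF e] insert.hyps insert.prems(2)[of \<psi>] X by simp
  with X show ?case
    using insert.prems(5) by blast
qed simp

text \<open>
  Over \<open>H\<close> a relation between characters splits according to their restrictions to \<open>H\<close>, by
  independence; hence it survives at every point \<open>z\<close> that does not separate characters with the
  same restriction.
\<close>

lemma character_relation_extends:
  fixes \<phi> :: "'k \<Rightarrow> 'b \<Rightarrow> 'a::field"
  assumes "finite I"
    and mult: "\<And>k x y. k \<in> I \<Longrightarrow> x \<in> H \<Longrightarrow> y \<in> H \<Longrightarrow> \<phi> k (m x y) = \<phi> k x * \<phi> k y"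
    and one: "\<And>k. k \<in> I \<Longrightarrow> \<phi> k e = 1" and e: "e \<in> H"
    and closed: "\<And>x y. x \<in> H \<Longrightarrow> y \<in> H \<Longrightarrow> m x y \<in> H"
    and agree: "\<And>k l. k \<in> I \<Longrightarrow> l \<in> I \<Longrightarrow> (\<And>x. x \<in> H \<Longrightarrow> \<phi> k x = \<phi> l x) \<Longrightarrow> \<phi> k z = \<phi> l z"
    and zero: "\<And>x. x \<in> H \<Longrightarrow> (\<Sum>k\<in>I. c k * \<phi> k x) = 0"
  shows "(\<Sum>k\<in>I. c k * \<phi> k z) = 0"
proof -
  \<comment> \<open>Restricting to \<open>H\<close> turns characters that agree on \<open>H\<close>
    into equal functions; \<open>d\<close> collects the coefficients of each such class.\<close>
  define r where "r k = restrict (\<phi> k) H" for k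
  define d where "d \<psi> = (\<Sum>k\<in>{k\<in>I. r k = \<psi>}. c k)" for \<psi>
  have r: "r k x = \<phi> k x" if "x \<in> H" for k x
    using that by (simp add: r_def)
  have d: "d \<psi> = 0" if "\<psi> \<in> r ` I" for \<psi>
  proof (rule characters_independent[where X = "r ` I" and H = H and c = d and m = m and e = e])
    show "\<exists>x\<in>H. f x \<noteq> \<psi> x" if "f \<in> r ` I" "\<psi> \<in> r ` I" "f \<noteq> \<psi>" for f \<psi>
      using that by (auto simp: r_def restrict_def)
    fix x assume x: "x \<in> H"
    have "(\<Sum>\<psi>\<in>r ` I. d \<psi> * \<psi> x) = (\<Sum>\<psi>\<in>r ` I. \<Sum>k\<in>{k\<in>I. r k = \<psi>}. c k * \<phi> k x)"
      unfolding d_def sum_distrib_right by (intro sum.cong refl) (use r x in auto)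
    also have "\<dots> = (\<Sum>k\<in>I. c k * \<phi> k x)"
      using sum.image_gen[OF \<open>finite I\<close>, of "\<lambda>k. c k * \<phi> k x" r] by simp
    finally show "(\<Sum>\<psi>\<in>r ` I. d \<psi> * \<psi> x) = 0"
      using zero x by simp
  qed (use that assms(1) mult one e closed r in auto)
  have "(\<Sum>k\<in>I. c k * \<phi> k z) = (\<Sum>\<psi>\<in>r ` I. \<Sum>k\<in>{k\<in>I. r k = \<psi>}. c k * \<phi> k z)"
    by (rule sum.image_gen[OF \<open>finite I\<close>])
  also have "\<dots> = 0"
  proof (rule sum.neutral, intro ballI)
    fix \<psi> assume "\<psi> \<in> r ` I"
    then obtain k0 where k0: "k0 \<in> I" "\<psi> = r k0"
      by blast
    have "\<phi> k z = \<phi> k0 z" if "k \<in> {k\<in>I. r k = \<psi>}" for k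
      using that k0 r by (intro agree) (auto, metis)
    then have "(\<Sum>k\<in>{k\<in>I. r k = \<psi>}. c k * \<phi> k z) = d \<psi> * \<phi> k0 z"
      unfolding d_def sum_distrib_right by (intro sum.cong refl) simp
    then show "(\<Sum>k\<in>{k\<in>I. r k = \<psi>}. c k * \<phi> k z) = 0"
      using d \<open>\<psi> \<in> r ` I\<close> by simp
  qed
  finally show ?thesis .
qed

section \<open>The identity component is cut out of the diagonal torus by characters\<close>

context monomial_cyclic_group
begin

lemma u_one: "u (mat 1) = (\<lambda>i. 1)"
  by (simp add: u_def conj_by_one P mat_entry fun_eq_iff)

lemma u_mult_fun: "A \<in> T \<Longrightarrow> u (A ** B) = (\<lambda>i. u A i * u B i)"
  by (simp add: u_mult fun_eq_iff)

lemma entry_eq_sum_u: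
  assumes "A \<in> T"
  shows "A $ i $ j = (\<Sum>k<n. P $ i $ e k * matrix_inv P $ e k $ j * u A k)"
proof -
  have "A $ i $ j = (P ** M A ** matrix_inv P) $ i $ j"
    by (simp add: conj_by_cancel P)
  also have "\<dots> = (\<Sum>l\<in>UNIV. (P ** M A) $ i $ l * matrix_inv P $ l $ j)"
    by (simp add: matrix_matrix_mult_def)
  also have "\<dots> = (\<Sum>l\<in>UNIV. P $ i $ l * matrix_inv P $ l $ j * M A $ l $ l)"
    using assms by (intro sum.cong) (simp_all add: T_def mult_diagonal_entry)
  also have "\<dots> = (\<Sum>k<n. P $ i $ e k * matrix_inv P $ e k $ j * u A k)"
    unfolding u_def by (rule sum.reindex_bij_betw[OF bij_e, symmetric])
  finally show ?thesis .
qed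

text \<open>On \<open>T\<close> the matrix entries are linear in the diagonal sequence and 1/det is
  the character with exponent -Phi, so regular functions restrict to Laurent polynomials. A list of
  coefficients and exponents may repeat exponents, so like terms are never collected.\<close>

lemma regular_Laurent_sum:
  assumes "f \<in> GL_regular"
  shows "\<exists>xs. \<forall>A\<in>T. f A = (\<Sum>(c, p)\<leftarrow>xs. c * lchar p (u A))"
  using assms unfolding GL_regular_def
proof (induction f rule: function_algebra.induct)
  case (gen f)
  then consider "f = (\<lambda>A. inverse (det A))" | i j where "f = (\<lambda>A. A $ i $ j)"
    by blast
  then show ?case
  proof cases
    case 1
    then show ?thesis
      by (intro exI[of _ "[(1, - geom_poly n)]"])
        (simp add: lchar_uminus lchar_geom_poly det_eq_prod_u)
  next
    case 2
    then show ?thesis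
      by (intro exI[of _ "map (\<lambda>k. (P $ i $ e k * matrix_inv P $ e k $ j, monom 1 k)) [0..<n]"])
        (simp add: entry_eq_sum_u interv_sum_list_conv_sum_set_nat o_def atLeast0LessThan)
  qed
next
  case (const c)
  then show ?case
    by (intro exI[of _ "[(c, 0)]"]) simp
next
  case (add f1 f2)
  then obtain xs ys where "\<forall>A\<in>T. f1 A = (\<Sum>(c, p)\<leftarrow>xs. c * lchar p (u A))"
    "\<forall>A\<in>T. f2 A = (\<Sum>(c, p)\<leftarrow>ys. c * lchar p (u A))"
    by blast
  then show ?case
    by (intro exI[of _ "xs @ ys"]) simp
next
  case (mult f1 f2)
  then obtain xs ys where xs: "\<forall>A\<in>T. f1 A = (\<Sum>(c, p)\<leftarrow>xs. c * lchar p (u A))"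
    and ys: "\<forall>A\<in>T. f2 A = (\<Sum>(c, p)\<leftarrow>ys. c * lchar p (u A))"
    by blast
  have scale: "(\<Sum>(c, p)\<leftarrow>map (\<lambda>(d, q). (c * d, p + q)) zs. c * lchar p (u A)) =
      c * lchar p (u A) * (\<Sum>(c, p)\<leftarrow>zs. c * lchar p (u A))" if "A \<in> T" for c p zs A
    by (induction zs) (use u_nonzero[OF that] in \<open>auto simp: lchar_add algebra_simps\<close>)
  have "(\<Sum>(c, p)\<leftarrow>concat (map (\<lambda>(c, p). map (\<lambda>(d, q). (c * d, p + q)) ys) ws). c * lchar p (u A)) =
      (\<Sum>(c, p)\<leftarrow>ws. c * lchar p (u A)) * (\<Sum>(c, p)\<leftarrow>ys. c * lchar p (u A))" if "A \<in> T" for ws A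
    by (induction ws) (use scale[OF that] in \<open>auto simp: algebra_simps\<close>)
  with xs ys show ?case
    by (intro exI[of _ "concat (map (\<lambda>(c, p). map (\<lambda>(d, q). (c * d, p + q)) ys) xs)"]) simp
qed

text \<open>An equation of \<open>H\<close>, written as a Laurent sum, is a relation between
  characters valid on \<open>H\<close>. By \<open>triv\<close>, characters that agree on
  \<open>H\<close> also agree at \<open>A\<close>, so the relation carries over to
  \<open>A\<close>.\<close>

lemma mem_H_if_characters_trivial:
  assumes "A \<in> T" and triv: "\<And>f. (\<And>B. B \<in> H \<Longrightarrow> lchar f (u B) = 1) \<Longrightarrow> lchar f (u A) = 1"
  shows "A \<in> H"
proof -
  obtain S where S: "S \<subseteq> GL_regular" "H = {A \<in> carrier GL. \<forall>f\<in>S. f A = 0}"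
    using closed_H unfolding zariski_closed_def by (elim exE conjE)
  have S_H: "f B = 0" if "f \<in> S" "B \<in> H" for f B
    using that(2) unfolding S(2) using that(1) by blast
  have "f A = 0" if fS: "f \<in> S" for f
  proof -
    have "\<exists>xs. \<forall>B\<in>T. f B = (\<Sum>(c, p)\<leftarrow>xs. c * lchar p (u B))"
      using fS S(1) by (intro regular_Laurent_sum) blast
    then obtain xs where xs: "\<And>B. B \<in> T \<Longrightarrow> f B = (\<Sum>(c, p)\<leftarrow>xs. c * lchar p (u B))"
      by blast
    have f: "f B = (\<Sum>k<length xs. fst (xs ! k) * lchar (snd (xs ! k)) (u B))" if "B \<in> T" for B
      by (simp add: xs[OF that] sum_list_sum_nth case_prod_unfold atLeast0LessThan)
    have "(\<Sum>k<length xs. fst (xs ! k) * lchar (snd (xs ! k)) (u A)) = 0"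
    proof (rule character_relation_extends[where H = H and m = "(**)" and e = "mat 1"])
      show "lchar (snd (xs ! k)) (u (B ** C)) = lchar (snd (xs ! k)) (u B) * lchar (snd (xs ! k)) (u C)"
        if "B \<in> H" for k B C
        using that H_subset_T by (simp add: u_mult_fun lchar_mult_seq subsetD)
      show "lchar (snd (xs ! k)) (u (mat 1)) = 1" for k
        by (simp add: u_one)
      show "lchar (snd (xs ! k)) (u A) = lchar (snd (xs ! l)) (u A)"
        if eq: "\<And>B. B \<in> H \<Longrightarrow> lchar (snd (xs ! k)) (u B) = lchar (snd (xs ! l)) (u B)" for k l
      proof -
        have "lchar (snd (xs ! k) - snd (xs ! l)) (u A) = 1"
        proof (rule triv)
          fix B assume B: "B \<in> H"
          then have "u B i \<noteq> 0" for i
            using H_subset_T u_nonzero by blast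
          then show "lchar (snd (xs ! k) - snd (xs ! l)) (u B) = 1"
            using eq[OF B] by (simp add: lchar_diff lchar_nonzero)
        qed
        then show ?thesis
          using u_nonzero[OF assms(1)] by (simp add: lchar_diff lchar_nonzero)
      qed
      show "(\<Sum>k<length xs. fst (xs ! k) * lchar (snd (xs ! k)) (u B)) = 0" if "B \<in> H" for B
        using f[of B] S_H[OF fS that] subsetD[OF H_subset_T that] by simp
    qed (auto simp: one_in_H mult_in_H)
    then show ?thesis
      using f assms(1) by simp
  qed
  then show ?thesis
    using assms(1) unfolding S(2) by (simp add: T_def)
qed

lemma regular_u_powi: "\<exists>F\<in>GL_regular. \<forall>A\<in>T. F A = u A i powi c"
proof (cases "c \<ge> 0")
  case True
  have "(\<lambda>A. u A i ^ nat c) \<in> GL_regular"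
    unfolding u_def by (intro GL_regular_power GL_regular_conj_by)
  with True show ?thesis
    by (intro bexI) (auto simp: power_int_def)
next
  case False
  \<comment> \<open>On \<open>T\<close> the determinant is the product over one period, so 1/det
    times the other entries inverts \<open>u A i\<close>; \<open>i mod n\<close> is the
    representative of \<open>i\<close> in that period.\<close>
  let ?F = "\<lambda>A. inverse (det A) * (\<Prod>k\<in>{..<n} - {i mod n}. u A k)"
  have "?F A = inverse (u A i)" if "A \<in> T" for A
  proof -
    have "det A = u A (i mod n) * (\<Prod>k\<in>{..<n} - {i mod n}. u A k)"
      using n_gt_1 unfolding det_eq_prod_u[OF that] by (intro prod.remove) auto
    then show ?thesis
      using u_nonzero[OF that] by (simp add: u_mod)
  qed
  moreover have "(\<lambda>A. ?F A ^ nat (- c)) \<in> GL_regular"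
    unfolding u_def
    by (intro GL_regular_power GL_regular_mult GL_regular_inverse_det GL_regular_prod GL_regular_conj_by)
  ultimately show ?thesis
    using False by (intro bexI) (auto simp: power_int_def power_inverse)
qed

lemma regular_lchar: "\<exists>F\<in>GL_regular. \<forall>A\<in>T. F A = lchar f (u A)"
proof -
  have "\<forall>i. \<exists>F. F \<in> GL_regular \<and> (\<forall>A\<in>T. F A = u A i powi coeff f i)"
    using regular_u_powi by blast
  then obtain F where "\<forall>i. F i \<in> GL_regular \<and> (\<forall>A\<in>T. F i A = u A i powi coeff f i)"
    by (rule choice[THEN exE])
  then have F: "\<And>i. F i \<in> GL_regular" "\<And>i A. A \<in> T \<Longrightarrow> F i A = u A i powi coeff f i"
    by blast+
  have "(\<lambda>A. \<Prod>i\<le>degree f. F i A) \<in> GL_regular"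
    by (intro GL_regular_prod F(1))
  then show ?thesis
    by (intro bexI) (auto simp: lchar_def F(2))
qed

text \<open>Saturation holds because a character agrees on \<open>H\<close> with a regular function,
  to which connectedness applies.\<close>

sublocale shift_invariant_family "u ` H" n
proof
  show "prime n"
    by (rule prime_n)
  show "\<exists>u\<in>u ` H. u (Suc 0) \<noteq> u 0"
    using not_scalar by blast
next
  fix v i assume "v \<in> u ` H"
  then obtain A where A: "A \<in> H" "v = u A"
    by blast
  show "v i \<noteq> 0" "v (i + n) = v i"
    using A u_nonzero H_subset_T u_periodic by blast+
  obtain B where B: "B \<in> H" "\<And>i. u B i = u A (Suc i)"
    using A(1) H_shift by blast
  then have "(\<lambda>i. v (Suc i)) = u B"
    using A by auto
  then show "(\<lambda>i. v (Suc i)) \<in> u ` H"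
    using B by blast
next
  fix m f v
  assume m: "(m::nat) > 0" and pow: "\<And>v. v \<in> u ` H \<Longrightarrow> lchar f v ^ m = 1" and v: "v \<in> u ` H"
  obtain A where A: "A \<in> H" "v = u A"
    using v by blast
  obtain F where F: "F \<in> GL_regular" "\<And>B. B \<in> H \<Longrightarrow> F B = lchar f (u B)"
    using regular_lchar H_subset_T by blast
  have "F A = 1"
    using connected_H F(1) m _ one_in_H _ A(1)
    by (rule connectedin_power_eq_1) (use F(2) pow one_in_H in \<open>auto simp: u_one\<close>)
  then show "lchar f v = 1"
    using F(2) A by simp
qed

text \<open>The case I = 0: characters trivial on \<open>H\<close> are trivial on all of
  \<open>T\<close> and impose no condition.\<close>

lemma H_eq_T:
  assumes "\<exists>A\<in>H. det A \<noteq> 1"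
  shows "H = T"
proof
  show "H \<subseteq> T"
    by (rule H_subset_T)
  have ex: "\<exists>v\<in>u ` H. (\<Prod>i<n. v i) \<noteq> 1"
    using assms H_subset_T by (auto simp: det_eq_prod_u subset_iff)
  show "T \<subseteq> H"
  proof
    fix A assume A: "A \<in> T"
    then show "A \<in> H"
    proof (rule mem_H_if_characters_trivial)
      fix f assume "\<And>B. B \<in> H \<Longrightarrow> lchar f (u B) = 1"
      then have "f \<in> ann"
        by (auto simp: ann_def)
      then show "lchar f (u A) = 1"
        using ann_trivial[OF ex] u_nonzero[OF A] u_periodic by blast
    qed
  qed
qed

text \<open>Each character trivial on \<open>H\<close> is a power of det on \<open>T\<close>, so det
  = 1 already implies all conditions.\<close>

lemma H_eq_T_det_1:
  assumes "\<And>A. A \<in> H \<Longrightarrow> det A = 1"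
  shows "H = {A \<in> T. det A = 1}"
proof
  show "H \<subseteq> {A \<in> T. det A = 1}"
    using H_subset_T assms by blast
  show "{A \<in> T. det A = 1} \<subseteq> H"
  proof safe
    fix A assume A: "A \<in> T" "det A = 1"
    show "A \<in> H"
      using A(1)
    proof (rule mem_H_if_characters_trivial)
      fix f assume "\<And>B. B \<in> H \<Longrightarrow> lchar f (u B) = 1"
      then have "f \<in> ann"
        by (auto simp: ann_def)
      moreover have "(\<Prod>i<n. u A i) = 1"
        using A by (simp add: det_eq_prod_u)
      ultimately show "lchar f (u A) = 1"
        using ann_trivial_prod_1[of f "u A"] u_nonzero[OF A(1)] u_periodic by blast
    qed
  qed
qed

end

subsection \<open>Diagonal tori\<close>

lemma carrier_torus: "carrier (torus m) = (\<Pi>\<^sub>E i\<in>{..<m}. UNIV - {0})"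
  and mult_torus: "s \<otimes>\<^bsub>torus m\<^esub> t = (\<lambda>i\<in>{..<m}. s i * t i)"
  by (simp_all add: torus_def Gm_def)

lemma torus_regular_coord: "i < m \<Longrightarrow> (\<lambda>t. t i) \<in> torus_regular m"
  and torus_regular_inverse_coord: "i < m \<Longrightarrow> (\<lambda>t. inverse (t i)) \<in> torus_regular m"
  unfolding torus_regular_def by (auto intro!: function_algebra.gen)

lemma torus_regular_const: "(\<lambda>t. c) \<in> torus_regular m"
  unfolding torus_regular_def by (rule function_algebra.const)

lemma torus_regular_add:
    "f \<in> torus_regular m \<Longrightarrow> g \<in> torus_regular m \<Longrightarrow> (\<lambda>t. f t + g t) \<in> torus_regular m"
  and torus_regular_mult:
    "f \<in> torus_regular m \<Longrightarrow> g \<in> torus_regular m \<Longrightarrow> (\<lambda>t. f t * g t) \<in> torus_regular m"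
  unfolding torus_regular_def by (rule function_algebra.add function_algebra.mult; assumption)+

lemma torus_regular_sum:
  "(\<And>i. i \<in> I \<Longrightarrow> f i \<in> torus_regular m) \<Longrightarrow> (\<lambda>t. \<Sum>i\<in>I. f i t) \<in> torus_regular m"
  by (induction I rule: infinite_finite_induct) (auto intro!: torus_regular_const torus_regular_add)

lemma torus_regular_prod:
  "(\<And>i. i \<in> I \<Longrightarrow> f i \<in> torus_regular m) \<Longrightarrow> (\<lambda>t. \<Prod>i\<in>I. f i t) \<in> torus_regular m"
  by (induction I rule: infinite_finite_induct) (auto intro!: torus_regular_const torus_regular_mult)

definition diag_mat :: "('n \<Rightarrow> 'a::zero) \<Rightarrow> 'a ^ 'n ^ 'n" where
  "diag_mat d = (\<chi> i j. if i = j then d i else 0)"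

lemma diag_mat_entry: "diag_mat d $ i $ j = (if i = j then d i else 0)"
  by (simp add: diag_mat_def)

lemma diagonal_diag_mat: "diagonal (diag_mat d)"
  by (simp add: diagonal_def diag_mat_entry)

lemma diag_mat_mult:
  fixes c d :: "'n::finite \<Rightarrow> 'a::comm_semiring_1"
  shows "diag_mat c ** diag_mat d = diag_mat (\<lambda>j. c j * d j)"
  by (simp add: vec_eq_iff diagonal_mult_entry diagonal_diag_mat diag_mat_entry)

lemma det_diag_mat: "det (diag_mat d) = (\<Prod>j\<in>UNIV. d j)"
  by (subst det_diagonal) (auto simp: diag_mat_entry)

lemma conj_by_inverse_mult:
  fixes P A B :: "'a::field ^ 'n ^ 'n"
  assumes "invertible P"
  shows "(P ** A ** matrix_inv P) ** (P ** B ** matrix_inv P) = P ** (A ** B) ** matrix_inv P"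
proof -
  have "(P ** A ** matrix_inv P) ** (P ** B ** matrix_inv P) =
      P ** A ** (matrix_inv P ** P) ** B ** matrix_inv P"
    by (simp only: matrix_mul_assoc)
  then show ?thesis
    using matrix_inv_invertible[OF assms] by (simp add: matrix_mul_assoc)
qed

text \<open>The parameter \<open>t i\<close> reappears as the diagonal entry at
  \<open>idx i\<close>, so reading off these entries inverts the parametrisation by a regular map.
  Entries at other positions may depend on all parameters, as they do for determinant 1.\<close>

lemma isomorphic_to_torusI:
  fixes P :: "'a::field ^ 'n ^ 'n" and d :: "(nat \<Rightarrow> 'a) \<Rightarrow> 'n \<Rightarrow> 'a"
  defines "\<psi> \<equiv> \<lambda>t. P ** diag_mat (d t) ** matrix_inv P"
  assumes P: "invertible P"
    and nonzero: "\<And>t j. t \<in> carrier (torus m) \<Longrightarrow> d t j \<noteq> 0"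
    and reg: "\<And>j. (\<lambda>t. d t j) \<in> torus_regular m"
    and inv_reg: "\<And>j. (\<lambda>t. inverse (d t j)) \<in> torus_regular m"
    and mult: "\<And>s t j. s \<in> carrier (torus m) \<Longrightarrow> t \<in> carrier (torus m) \<Longrightarrow>
        d (s \<otimes>\<^bsub>torus m\<^esub> t) j = d s j * d t j"
    and idx: "\<And>t i. t \<in> carrier (torus m) \<Longrightarrow> i < m \<Longrightarrow> d t (idx i) = t i"
    and H: "H = \<psi> ` carrier (torus m)"
  shows "isomorphic_to_torus H m"
proof -
  define \<phi> where "\<phi> A = (\<lambda>i\<in>{..<m}. conj_by P A $ idx i $ idx i)" for A
  have conj\<psi>: "conj_by P (\<psi> t) = diag_mat (d t)" for t
    by (simp add: \<psi>_def conj_by_cancel P)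
  have \<phi>\<psi>: "\<phi> (\<psi> t) = t" if "t \<in> carrier (torus m)" for t
  proof
    fix i
    show "\<phi> (\<psi> t) i = t i"
    proof (cases "i < m")
      case True
      then show ?thesis
        using idx[OF that True] by (simp add: \<phi>_def conj\<psi> diag_mat_entry)
    next
      case False
      then have "t i = undefined"
        using PiE_arb[OF that[unfolded carrier_torus]] by simp
      then show ?thesis
        using False by (simp add: \<phi>_def)
    qed
  qed
  have \<psi>\<phi>: "\<psi> (\<phi> A) = A" if "A \<in> H" for A
    using that \<phi>\<psi> unfolding H by force
  have \<phi>H: "\<phi> A \<in> carrier (torus m)" if "A \<in> H" for A
    using that \<phi>\<psi> unfolding H by force
  have \<psi>H: "\<psi> t \<in> H" if "t \<in> carrier (torus m)" for t
    using that unfolding H by blast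
  have closed: "s \<otimes>\<^bsub>torus m\<^esub> t \<in> carrier (torus m)"
    if "s \<in> carrier (torus m)" "t \<in> carrier (torus m)" for s t :: "nat \<Rightarrow> 'a"
    using that by (auto simp: carrier_torus mult_torus PiE_iff)
  have \<psi>_mult: "\<psi> s ** \<psi> t = \<psi> (s \<otimes>\<^bsub>torus m\<^esub> t)"
    if "s \<in> carrier (torus m)" "t \<in> carrier (torus m)" for s t
  proof -
    have "d (s \<otimes>\<^bsub>torus m\<^esub> t) = (\<lambda>j. d s j * d t j)"
      using mult[OF that] by (rule ext)
    then show ?thesis
      by (simp add: \<psi>_def conj_by_inverse_mult P diag_mat_mult)
  qed
  have "\<phi> \<in> iso (GL\<lparr>carrier := H\<rparr>) (torus m)"
    unfolding iso_def
  proof (intro CollectI conjI homI)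
    fix A B assume "A \<in> carrier (GL\<lparr>carrier := H\<rparr>)" "B \<in> carrier (GL\<lparr>carrier := H\<rparr>)"
    then have "A \<in> H" "B \<in> H"
      by simp_all
    then have "A ** B = \<psi> (\<phi> A \<otimes>\<^bsub>torus m\<^esub> \<phi> B)"
      using \<psi>_mult[of "\<phi> A" "\<phi> B"] by (simp add: \<phi>H \<psi>\<phi>)
    then show "\<phi> (A \<otimes>\<^bsub>GL\<lparr>carrier := H\<rparr>\<^esub> B) = \<phi> A \<otimes>\<^bsub>torus m\<^esub> \<phi> B"
      using \<open>A \<in> H\<close> \<open>B \<in> H\<close> by (simp add: \<phi>\<psi> closed \<phi>H)
  next
    show "bij_betw \<phi> (carrier (GL\<lparr>carrier := H\<rparr>)) (carrier (torus m))"
      by (rule bij_betw_byWitness[where f' = \<psi>]) (auto simp: \<phi>\<psi> \<psi>\<phi> \<phi>H \<psi>H)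
  qed (simp add: \<phi>H)
  moreover have "regular_map H GL_regular (carrier (torus m)) (torus_regular m) \<phi>"
    unfolding regular_map_def
  proof (intro conjI ballI)
    show "\<phi> \<in> H \<rightarrow> carrier (torus m)"
      using \<phi>H by blast
    fix f :: "(nat \<Rightarrow> 'a) \<Rightarrow> 'a" assume "f \<in> torus_regular m"
    then show "\<exists>g\<in>GL_regular. \<forall>A\<in>H. f (\<phi> A) = g A"
      unfolding torus_regular_def
    proof (induction f rule: function_algebra.induct)
      case (gen f)
      then consider i where "i < m" "f = (\<lambda>t. t i)" | i where "i < m" "f = (\<lambda>t. inverse (t i))"
        by blast
      then show ?case
      proof cases
        case 1
        then show ?thesis
          by (intro bexI[OF _ GL_regular_conj_by[of P "idx i" "idx i"]]) (simp add: \<phi>_def)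
      next
        case 2
        \<comment> \<open>The inverse of one diagonal entry, expressed through 1/det and the other
          entries.\<close>
        let ?F = "\<lambda>A. inverse (det A) * (\<Prod>j\<in>UNIV - {idx i}. conj_by P A $ j $ j)"
        have "inverse (conj_by P A $ idx i $ idx i) = ?F A" if "A \<in> H" for A
        proof -
          obtain t where t: "t \<in> carrier (torus m)" "A = \<psi> t"
            using \<open>A \<in> H\<close> unfolding H by blast
          have "det A = det (conj_by P A)"
            by (simp add: det_conj_by P)
          also have "\<dots> = d t (idx i) * (\<Prod>j\<in>UNIV - {idx i}. d t j)"
            by (simp add: t(2) conj\<psi> det_diag_mat prod.remove[of UNIV "idx i"])
          finally show ?thesis
            using nonzero[OF t(1)] by (simp add: t(2) conj\<psi> diag_mat_entry)
        qed
        moreover have "?F \<in> GL_regular"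
          by (intro GL_regular_mult GL_regular_inverse_det GL_regular_prod GL_regular_conj_by)
        ultimately show ?thesis
          using 2 by (intro bexI[of _ ?F]) (simp_all add: \<phi>_def)
      qed
    next
      case (const c)
      then show ?case
        by (intro bexI[OF _ GL_regular_const[of c]]) simp
    next
      case (add f1 f2)
      then obtain g1 g2 where "g1 \<in> GL_regular" "g2 \<in> GL_regular"
        "\<forall>A\<in>H. f1 (\<phi> A) = g1 A" "\<forall>A\<in>H. f2 (\<phi> A) = g2 A"
        by blast
      then show ?case
        by (intro bexI[of _ "\<lambda>A. g1 A + g2 A"] GL_regular_add) auto
    next
      case (mult f1 f2)
      then obtain g1 g2 where "g1 \<in> GL_regular" "g2 \<in> GL_regular"
        "\<forall>A\<in>H. f1 (\<phi> A) = g1 A" "\<forall>A\<in>H. f2 (\<phi> A) = g2 A"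
        by blast
      then show ?case
        by (intro bexI[of _ "\<lambda>A. g1 A * g2 A"] GL_regular_mult) auto
    qed
  qed
  moreover have "regular_map (carrier (torus m)) (torus_regular m) H GL_regular \<psi>"
    unfolding regular_map_def
  proof (intro conjI ballI)
    show "\<psi> \<in> carrier (torus m) \<rightarrow> H"
      using \<psi>H by blast
    fix f :: "'a ^ 'n ^ 'n \<Rightarrow> 'a" assume "f \<in> GL_regular"
    then have "(\<lambda>t. f (\<psi> t)) \<in> torus_regular m"
      unfolding GL_regular_def
    proof (induction f rule: function_algebra.induct)
      case (gen f)
      then consider "f = (\<lambda>A. inverse (det A))" | i j where "f = (\<lambda>A. A $ i $ j)"
        by blast
      then show ?case
      proof cases
        case 1
        have "det (\<psi> t) = (\<Prod>j\<in>UNIV. d t j)" for t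
          using det_conj_by[OF P, of "\<psi> t"] by (simp add: conj\<psi> det_diag_mat)
        then have "(\<lambda>t. f (\<psi> t)) = (\<lambda>t. \<Prod>j\<in>UNIV. inverse (d t j))"
          by (simp add: 1 prod_inversef[symmetric] o_def)
        then show ?thesis
          using torus_regular_prod[OF inv_reg] by simp
      next
        case 2
        have "(\<lambda>t. f (\<psi> t)) = (\<lambda>t. \<Sum>l\<in>UNIV. P $ i $ l * d t l * matrix_inv P $ l $ j)"
        proof
          fix t
          have "f (\<psi> t) = (\<Sum>l\<in>UNIV. (P ** diag_mat (d t)) $ i $ l * matrix_inv P $ l $ j)"
            by (simp add: 2 \<psi>_def matrix_matrix_mult_def)
          also have "\<dots> = (\<Sum>l\<in>UNIV. P $ i $ l * d t l * matrix_inv P $ l $ j)"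
            by (simp add: mult_diagonal_entry diagonal_diag_mat diag_mat_entry)
          finally show "f (\<psi> t) = (\<Sum>l\<in>UNIV. P $ i $ l * d t l * matrix_inv P $ l $ j)" .
        qed
        then show ?thesis
          by (simp only:) (intro torus_regular_sum torus_regular_mult torus_regular_const reg)
      qed
    qed (auto intro: torus_regular_const torus_regular_add torus_regular_mult)
    then show "\<exists>g\<in>torus_regular m. \<forall>t\<in>carrier (torus m). f (\<psi> t) = g t"
      by (intro bexI[of _ "\<lambda>t. f (\<psi> t)"]) simp_all
  qed
  ultimately show ?thesis
    unfolding isomorphic_to_torus_def using \<psi>\<phi> \<phi>\<psi> by blast
qed

section \<open>Coordinates on the two possible identity components\<close>

context monomial_cyclic_group
begin

definition e_inv :: "'n \<Rightarrow> nat" where "e_inv = inv_into {..<n} e"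

lemma e_inv_less: "e_inv j < n" and e_e_inv: "e (e_inv j) = j"
  and e_inv_e: "i < n \<Longrightarrow> e_inv (e i) = i"
  using bij_e by (auto simp: e_inv_def bij_betw_def inv_into_into f_inv_into_f
      intro: inv_into_into[of _ e "{..<n}", simplified])

lemma diag_conj_T:
  assumes "\<And>j. d j \<noteq> 0"
  shows "P ** diag_mat d ** matrix_inv P \<in> T" "u (P ** diag_mat d ** matrix_inv P) i = d (e i)"
proof -
  have M: "M (P ** diag_mat d ** matrix_inv P) = diag_mat d"
    by (simp add: conj_by_cancel P)
  have "det (P ** diag_mat d ** matrix_inv P) = (\<Prod>j\<in>UNIV. d j)"
    using det_conj_by[OF P, of "P ** diag_mat d ** matrix_inv P"]
    unfolding M by (simp only: det_diag_mat)
  then have "det (P ** diag_mat d ** matrix_inv P) \<noteq> 0"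
    using assms by simp
  then show "P ** diag_mat d ** matrix_inv P \<in> T"
    by (simp add: T_def M diagonal_diag_mat invertible_det_nz)
  show "u (P ** diag_mat d ** matrix_inv P) i = d (e i)"
    by (simp add: u_def M diag_mat_entry)
qed

lemma isomorphic_to_torus_T: "isomorphic_to_torus T n"
proof (rule isomorphic_to_torusI[OF P])
  let ?d = "\<lambda>t j. t (e_inv j)"
  let ?\<psi> = "\<lambda>t. P ** diag_mat (?d t) ** matrix_inv P"
  show nz: "?d t j \<noteq> 0" if "t \<in> carrier (torus n)" for t :: "nat \<Rightarrow> 'a" and j
    using that e_inv_less[of j] by (auto simp: carrier_torus PiE_iff)
  show "(\<lambda>t. ?d t j) \<in> torus_regular n" "(\<lambda>t. inverse (?d t j)) \<in> torus_regular n" for j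
    using e_inv_less by (auto intro: torus_regular_coord torus_regular_inverse_coord)
  show "?d (s \<otimes>\<^bsub>torus n\<^esub> t) j = ?d s j * ?d t j" for s t :: "nat \<Rightarrow> 'a" and j
    using e_inv_less by (simp add: mult_torus)
  show "?d t (e i) = t i" if "i < n" for t :: "nat \<Rightarrow> 'a" and i
    using that by (simp add: e_inv_e)
  show "T = ?\<psi> ` carrier (torus n)"
  proof
    show "?\<psi> ` carrier (torus n) \<subseteq> T"
    proof (rule image_subsetI)
      fix t :: "nat \<Rightarrow> 'a" assume "t \<in> carrier (torus n)"
      then show "?\<psi> t \<in> T"
        by (intro diag_conj_T(1) nz)
    qed
    show "T \<subseteq> ?\<psi> ` carrier (torus n)"
    proof
      fix A assume A: "A \<in> T"
      define t where "t = (\<lambda>i\<in>{..<n}. u A i)"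
      have t: "t \<in> carrier (torus n)"
        using u_nonzero[OF A] by (auto simp: t_def carrier_torus)
      have "A = ?\<psi> t"
      proof (rule T_eqI[OF A])
        show "?\<psi> t \<in> T"
          by (intro diag_conj_T(1) nz t)
        fix i assume "i < n"
        have "u (?\<psi> t) i = t (e_inv (e i))"
          by (intro diag_conj_T(2) nz t)
        then show "u A i = u (?\<psi> t) i"
          using \<open>i < n\<close> by (simp add: e_inv_e t_def)
      qed
      then show "A \<in> ?\<psi> ` carrier (torus n)"
        using t by blast
    qed
  qed
qed

lemma isomorphic_to_torus_T_det_1: "isomorphic_to_torus {A \<in> T. det A = 1} (n - 1)"
proof (rule isomorphic_to_torusI[OF P])
  let ?m = "n - 1"
  \<comment> \<open>The first \<open>n - 1\<close> entries along the cycle are free; the last, at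
    position \<open>n - 1\<close>, is forced by determinant 1.\<close>
  let ?d = "\<lambda>t j. if e_inv j < ?m then t (e_inv j) else (\<Prod>k<?m. inverse (t k))"
  let ?\<psi> = "\<lambda>t. P ** diag_mat (?d t) ** matrix_inv P"
  have n: "n = Suc ?m"
    using n_gt_1 by simp
  have prod: "(\<Prod>i<n. v i) = (\<Prod>i<?m. v i) * v ?m" for v :: "nat \<Rightarrow> 'a"
    by (subst n) simp
  have t_nz: "t k \<noteq> 0" if "t \<in> carrier (torus ?m)" "k < ?m" for t :: "nat \<Rightarrow> 'a" and k
    using that by (auto simp: carrier_torus PiE_iff)
  show nz: "?d t j \<noteq> 0" if "t \<in> carrier (torus ?m)" for t :: "nat \<Rightarrow> 'a" and j
    using t_nz[OF that] by auto
  show "(\<lambda>t. ?d t j) \<in> torus_regular ?m" for j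
    by (cases "e_inv j < ?m")
      (auto intro!: torus_regular_coord torus_regular_prod torus_regular_inverse_coord)
  show "(\<lambda>t. inverse (?d t j)) \<in> torus_regular ?m" for j
    by (cases "e_inv j < ?m")
      (auto intro!: torus_regular_coord torus_regular_prod torus_regular_inverse_coord
        simp: prod_inversef[symmetric] o_def)
  show "?d (s \<otimes>\<^bsub>torus ?m\<^esub> t) j = ?d s j * ?d t j" for s t :: "nat \<Rightarrow> 'a" and j
    by (simp add: mult_torus prod.distrib)
  show "?d t (e i) = t i" if "i < ?m" for t :: "nat \<Rightarrow> 'a" and i
    using that by (simp add: e_inv_e)
  show "{A \<in> T. det A = 1} = ?\<psi> ` carrier (torus ?m)"
  proof
    show "?\<psi> ` carrier (torus ?m) \<subseteq> {A \<in> T. det A = 1}"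
    proof safe
      fix t :: "nat \<Rightarrow> 'a" assume t: "t \<in> carrier (torus ?m)"
      show T: "?\<psi> t \<in> T"
        by (rule diag_conj_T(1)) (rule nz[OF t])
      have u: "u (?\<psi> t) i = ?d t (e i)" for i
        by (rule diag_conj_T(2)) (rule nz[OF t])
      have "det (?\<psi> t) = (\<Prod>k<?m. u (?\<psi> t) k) * u (?\<psi> t) ?m"
        unfolding det_eq_prod_u[OF T] by (rule prod)
      also have "(\<Prod>k<?m. u (?\<psi> t) k) = (\<Prod>k<?m. t k)"
        unfolding u by (rule prod.cong) (simp_all add: e_inv_e)
      also have "u (?\<psi> t) ?m = (\<Prod>k<?m. inverse (t k))"
        unfolding u using n_gt_1 by (simp add: e_inv_e)
      also have "(\<Prod>k<?m. t k) * (\<Prod>k<?m. inverse (t k)) = (\<Prod>k<?m. t k * inverse (t k))"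
        by (rule prod.distrib[symmetric])
      also have "\<dots> = (\<Prod>k<?m. 1)"
        by (rule prod.cong) (use t_nz[OF t] in auto)
      finally show "det (?\<psi> t) = 1"
        by simp
    qed
    show "{A \<in> T. det A = 1} \<subseteq> ?\<psi> ` carrier (torus ?m)"
    proof
      fix A assume "A \<in> {A \<in> T. det A = 1}"
      then have A: "A \<in> T" "(\<Prod>i<?m. u A i) * u A ?m = 1"
        by (auto simp: det_eq_prod_u prod)
      define t where "t = (\<lambda>i\<in>{..<?m}. u A i)"
      have t: "t \<in> carrier (torus ?m)"
        using u_nonzero[OF A(1)] by (auto simp: t_def carrier_torus)
      have last: "(\<Prod>k<?m. inverse (t k)) = u A ?m"
        using inverse_unique[OF A(2)] by (simp add: t_def prod_inversef[symmetric] o_def)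
      have "A = ?\<psi> t"
      proof (rule T_eqI[OF A(1)])
        show "?\<psi> t \<in> T"
          by (rule diag_conj_T(1)) (rule nz[OF t])
        fix i assume "i < n"
        have "u (?\<psi> t) i = ?d t (e i)"
          by (rule diag_conj_T(2)) (rule nz[OF t])
        also have "\<dots> = u A i"
        proof (cases "i < ?m")
          case True
          then show ?thesis
            by (simp add: e_inv_e t_def)
        next
          case False
          then have "i = ?m"
            using \<open>i < n\<close> by simp
          then show ?thesis
            using last \<open>i < n\<close> by (simp add: e_inv_e)
        qed
        finally show "u A i = u (?\<psi> t) i" ..
      qed
      then show "A \<in> ?\<psi> ` carrier (torus ?m)"
        using t by blast
    qed
  qed
qed

end

subsection \<open>The component group\<close>

text \<open>The isomorphism is abstract and need not send \<open>x\<close> to 1. As the powers of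
  \<open>x\<close> exhaust \<open>D\<close>, some multiple of \<open>f x\<close> is 1 modulo \<nu>,
  so \<open>f x\<close> is a unit there and \<open>x\<close> has order \<nu>.\<close>

lemma power_eq_1_iff_dvd:
  fixes x :: "'a::field"
  assumes powers: "D = range (\<lambda>k::nat. x ^ k)" and \<nu>: "\<nu> \<ge> 1"
    and iso: "Gm\<lparr>carrier := D\<rparr> \<cong> integer_mod_group \<nu>"
  shows "x ^ k = 1 \<longleftrightarrow> \<nu> dvd k"
proof -
  obtain f where f: "f \<in> iso (Gm\<lparr>carrier := D\<rparr>) (integer_mod_group \<nu>)"
    using iso unfolding is_iso_def by blast
  have D: "x ^ k \<in> D" for k
    using powers by blast
  have bij: "bij_betw f D {0..<int \<nu>}"
    using f \<nu> by (simp add: iso_def carrier_integer_mod_group)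
  have hom: "f (y * z) = (f y + f z) mod int \<nu>" if "y \<in> D" "z \<in> D" for y z
    using f that by (simp add: iso_def hom_def Gm_def)
  have "f 1 = (f 1 + f 1) mod int \<nu>"
    using hom[of 1 1] D[of 0] by simp
  moreover have "0 \<le> f 1" "f 1 < int \<nu>"
    using bij_betw_apply[OF bij D[of 0]] by simp_all
  ultimately have f1: "f 1 = 0"
    by (metis add_diff_cancel_left' mod_eq_dvd_iff mod_pos_pos_trivial order_le_less zdvd_not_zless)
  have fk: "f (x ^ k) = (int k * f x) mod int \<nu>" for k
  proof (induction k)
    case (Suc k)
    have "f (x ^ Suc k) = (f x + f (x ^ k)) mod int \<nu>"
      using hom[of x "x ^ k"] D[of 1] D[of k] by simp
    then show ?case
      by (simp add: Suc algebra_simps mod_add_right_eq)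
  qed (simp add: f1)
  show ?thesis
  proof
    assume "\<nu> dvd k"
    then have "f (x ^ k) = f 1"
      by (simp add: fk f1)
    then show "x ^ k = 1"
      using bij D[of k] D[of 0] by (auto simp: bij_betw_def inj_on_def)
  next
    assume "x ^ k = 1"
    then have k: "int \<nu> dvd int k * f x"
      using fk[of k] by (simp add: f1 mod_eq_0_iff_dvd)
    have "1 mod int \<nu> \<in> f ` D"
      using bij \<nu> by (simp add: bij_betw_def)
    then obtain j where "f (x ^ j) = 1 mod int \<nu>"
      unfolding powers by auto
    then have "int \<nu> dvd int j * f x - 1"
      by (simp add: fk mod_eq_dvd_iff)
    then have "int \<nu> dvd int k * (int j * f x - 1)"
      by simp
    moreover have "int \<nu> dvd int j * (int k * f x)"
      using k by simp
    \<comment> \<open>With j * f x = 1 modulo \<nu>, this combination eliminates \<open>f x\<close>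
      and leaves \<open>k\<close>.\<close>
    ultimately have "int \<nu> dvd int j * (int k * f x) - int k * (int j * f x - 1)"
      by (rule dvd_diff[rotated])
    also have "int j * (int k * f x) - int k * (int j * f x - 1) = int k"
      by (simp add: algebra_simps)
    finally show "\<nu> dvd k"
      by simp
  qed
qed

text \<open>The inverse of \<open>x\<close> would be a natural power of \<open>x\<close>, making
  \<open>x\<close> a root of unity; then all units would be roots of one polynomial.\<close>

lemma powers_not_all_units:
  fixes x :: "'a::field"
  assumes "infinite (UNIV :: 'a set)"
  shows "range (\<lambda>k::nat. x ^ k) \<noteq> UNIV - {0}"
proof
  assume units: "range (\<lambda>k::nat. x ^ k) = UNIV - {0}"
  have "x ^ 1 \<in> range (\<lambda>k::nat. x ^ k)"
    by blast
  then have "x \<noteq> 0"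
    unfolding units by simp
  then have "inverse x \<in> range (\<lambda>k::nat. x ^ k)"
    unfolding units by simp
  then obtain k :: nat where "inverse x = x ^ k"
    by blast
  then have x: "x ^ Suc k = 1"
    using \<open>x \<noteq> 0\<close> by (metis power_Suc right_inverse)
  have "UNIV \<subseteq> insert 0 {y::'a. y ^ Suc k = 1}"
  proof
    fix y :: 'a
    show "y \<in> insert 0 {y. y ^ Suc k = 1}"
    proof (cases "y = 0")
      case False
      then obtain j where "y = x ^ j"
        using units by blast
      then have "y ^ Suc k = 1"
        using x by (metis power_mult mult.commute power_one)
      then show ?thesis
        by blast
    qed simp
  qed
  then show False
    using assms finite_roots_of_unity[of "Suc k"]
    by (metis finite_insert finite_subset zero_less_Suc)
qed

lemma field_embedding_infinite:
  fixes \<iota> :: "'a::field \<Rightarrow> complex"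
  assumes "field_embedding \<iota>"
  shows "infinite (UNIV :: 'a set)"
proof -
  have "\<iota> (of_nat k) = of_nat k" for k
    using assms by (induction k) (simp_all add: field_embedding_def)
  then have "inj (of_nat :: nat \<Rightarrow> 'a)"
    by (metis injI of_nat_eq_iff)
  then show ?thesis
    using finite_imageD[of "of_nat :: nat \<Rightarrow> 'a" UNIV] finite_subset[OF subset_UNIV] by blast
qed

section \<open>Powers of the generator and their determinants\<close>

context monomial_cyclic_group
begin

lemma g_pow_T_iff: "g [^]\<^bsub>GL\<^esub> k \<in> T \<longleftrightarrow> n dvd k"
  by (simp add: T_def diagonal_g_pow_iff invertible_pow_GL invertible_G g)

lemma det_g_pow: "det (g [^]\<^bsub>GL\<^esub> (k::nat)) = det g ^ k"
  by (induction k) (simp_all add: pow_GL_0 pow_GL_Suc2 det_mul det_I)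

lemma g_pow_in_G: "g [^]\<^bsub>GL\<^esub> (k::nat) \<in> G"
  by (induction k) (simp_all add: pow_GL_0 pow_GL_Suc2 one_in_G mult_in_G g)

lemma det_G_powers:
  assumes "\<And>A. A \<in> H \<Longrightarrow> det A = 1"
  shows "det ` G = range (\<lambda>k::nat. det g ^ k)"
proof
  show "det ` G \<subseteq> range (\<lambda>k::nat. det g ^ k)"
  proof
    fix x assume "x \<in> det ` G"
    then obtain A where "A \<in> G" "x = det A"
      by blast
    moreover obtain h and k :: nat where "h \<in> H" "A = h ** g [^]\<^bsub>GL\<^esub> k"
      using generates[OF \<open>A \<in> G\<close>] by blast
    ultimately have "x = det g ^ k"
      by (simp add: det_mul assms det_g_pow)
    then show "x \<in> range (\<lambda>k::nat. det g ^ k)"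
      by blast
  qed
  show "range (\<lambda>k::nat. det g ^ k) \<subseteq> det ` G"
    using g_pow_in_G by (auto simp flip: det_g_pow)
qed

end

theorem mainTheorem3:
  fixes G :: "('a::alg_closed_field ^ 'n::finite ^ 'n) set"
    and \<iota> :: "'a \<Rightarrow> complex"
  assumes "field_embedding \<iota>"
    and "prime CARD('n)"
    and "algebraic_group G"
    and "irreducible_group G"
    and "imprimitive_group G"
    and "finite (carrier (component_group G))"
    and "cyclic_group (component_group G)"
  shows "(det ` G = UNIV - {0} \<longrightarrow>
            isomorphic_to_torus (identity_component G) CARD('n) \<and>
            component_group G \<cong> integer_mod_group CARD('n))
       \<and> (\<forall>\<nu>::nat. \<nu> \<ge> 1 \<and> Gm\<lparr>carrier := det ` G\<rparr> \<cong> integer_mod_group \<nu> \<longrightarrow>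
            isomorphic_to_torus (identity_component G) (CARD('n) - 1) \<and>
            component_group G \<cong>
              integer_mod_group (CARD('n) * (if CARD('n) dvd \<nu> then \<nu> div CARD('n) else \<nu>)))"
proof -
  interpret cyclic_component_group G
    using assms by unfold_locales
  obtain P :: "'a ^ 'n ^ 'n" where P: "invertible P"
    "\<And>A. A \<in> G \<Longrightarrow> \<exists>\<pi>. \<forall>i j. conj_by P A $ i $ j \<noteq> 0 \<longleftrightarrow> i = \<pi> j"
    using imprimitive_monomial_form[OF assms(2,4,5) invertible_G mult_in_G one_in_G] by blast
  obtain g where g: "g \<in> G" "\<And>A. A \<in> G \<Longrightarrow> \<exists>h\<in>H. \<exists>k::nat. A = h ** (g [^]\<^bsub>GL\<^esub> k)"
    and order: "\<And>N. N > 0 \<Longrightarrow> (\<And>k::nat. g [^]\<^bsub>GL\<^esub> k \<in> H \<longleftrightarrow> N dvd k) \<Longrightarrow>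
        component_group G \<cong> integer_mod_group N"
    by (rule component_generator) blast
  interpret monomial_cyclic_group G P g "CARD('n)"
    using assms(2,4) P g by unfold_locales auto
  let ?n = "CARD('n)"
  show ?thesis
  proof (intro conjI[of "_ \<longrightarrow> _"] allI impI; (elim conjE)?)
    assume units: "det ` G = UNIV - {0}"
    \<comment> \<open>Otherwise the powers of det(g) would be all units of an infinite
      field.\<close>
    have "\<exists>A\<in>H. det A \<noteq> 1"
      using det_G_powers powers_not_all_units[OF field_embedding_infinite[OF assms(1)]] units
      by metis
    then have H: "H = T"
      by (rule H_eq_T)
    show "isomorphic_to_torus H ?n \<and> component_group G \<cong> integer_mod_group ?n"
    proof
      show "isomorphic_to_torus H ?n"
        unfolding H by (rule isomorphic_to_torus_T)
      show "component_group G \<cong> integer_mod_group ?n"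
        using n_gt_1 by (intro order) (simp_all add: H g_pow_T_iff)
    qed
  next
    fix \<nu> :: nat
    assume \<nu>: "\<nu> \<ge> 1" and iso: "Gm\<lparr>carrier := det ` G\<rparr> \<cong> integer_mod_group \<nu>"
    obtain f where "f \<in> iso (Gm\<lparr>carrier := det ` G\<rparr>) (integer_mod_group \<nu>)"
      using iso unfolding is_iso_def by blast
    then have "bij_betw f (det ` G) {0..<int \<nu>}"
      using \<nu> by (simp add: iso_def carrier_integer_mod_group)
    then have "finite (det ` G)"
      using bij_betw_finite by blast
    then have "finite (det ` H)"
      using H_subset by (meson finite_subset image_mono)
    \<comment> \<open>The determinant is regular with finitely many values on the connected
      \<open>H\<close>, hence constant.\<close>
    then have det1: "det A = 1" if "A \<in> H" for A
      using connectedin_finite_image[OF connected_H GL_regular_det _ that one_in_H]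
      by (simp add: det_I)
    then have H: "H = {A \<in> T. det A = 1}"
      by (rule H_eq_T_det_1)
    let ?s = "if ?n dvd \<nu> then \<nu> div ?n else \<nu>"
    \<comment> \<open>The number \<open>?n * ?s\<close> is the least common multiple of
      \<open>n\<close> and \<nu>: a prime either divides \<nu> or is coprime to it.\<close>
    have "(?n dvd k \<and> \<nu> dvd k) \<longleftrightarrow> ?n * ?s dvd k" for k
    proof (cases "?n dvd \<nu>")
      case False
      then have "coprime ?n \<nu>"
        using prime_n by (simp add: prime_imp_coprime)
      then show ?thesis
        using False by (auto intro: divides_mult dest: dvd_mult_left dvd_mult_right)
    qed (auto dest: dvd_trans)
    then have "g [^]\<^bsub>GL\<^esub> k \<in> H \<longleftrightarrow> ?n * ?s dvd k" for k :: nat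
      using power_eq_1_iff_dvd[OF det_G_powers[OF det1] \<nu> iso]
      by (simp add: H g_pow_T_iff det_g_pow)
    moreover have "?n * ?s > 0"
      using \<nu> n_gt_1 by (auto elim!: dvdE)
    ultimately have "component_group G \<cong> integer_mod_group (?n * ?s)"
      by (intro order)
    then show "isomorphic_to_torus H (?n - 1) \<and> component_group G \<cong> integer_mod_group (?n * ?s)"
      using isomorphic_to_torus_T_det_1 by (simp add: H)
  qed
qed

end
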